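(* Let the standing assumptions (A1)-(A5) of the context hold. Let $\varepsilon$ and $\eta$ be arbitrary positive numbers. Then there exist positive constants $\tilde C_{\eta,1}$ and $\tilde C_{\eta,2}$ such that for every solution $u^h,p^h$ of the semi-discrete scheme of the context and all $t\in[0,T_{max}]$ $$\begin{aligned}&\frac1{2h}\sum_{\ell\in\mathbb Z}\lambda_\ell^2\int_0^{t\wedge T_h}\sum_{i=1}^{L_h}\Big(\int_{\mathcal O}\partial_h^-\big((M_2^h(u^h)g_\ell)_x\big)e_{i+1}\,dx\Big)^2ds\\&\le(1+\eta)C_{Strat}\Big\{\big(1+\varepsilon\tfrac{n-2}2\big)C_{osc}^{n-2}\int_0^{t\wedge T_h}h\sum_{i=1}^{L_h}(u^h_i)^{n-2}|(\Delta_hu^h)_i|^2\,ds\\&\quad+\Big(\tfrac{(n-2)^2}4+\tfrac{n-2}{2\varepsilon}\Big)C_{osc}^{4-n}\int_0^{t\wedge T_h}h\sum_{i=1}^{L_h}(u^h_i)^{n-4}\Big(\Big|\tfrac{u^h_{i+1}-u^h_i}h\Big|^4+2\Big|\tfrac{u^h_{i+1}-u^h_i}h\Big|^2\Big|\tfrac{u^h_i-u^h_{i-1}}h\Big|^2+\Big|\tfrac{u^h_i-u^h_{i-1}}h\Big|^4\Big)ds\Big\}\\&\quad+\tilde C_{\eta,1}\int_0^{t\wedge T_h}h\sum_{i=1}^{L_h}(u^h_i)^{n-2}\Big|\tfrac{u^h_{i+1}-u^h_i}h\Big|^2ds+\tilde C_{\eta,2}\int_0^{t\wedge T_h}\int_{\mathcal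 O}(u^h)^n\,dx\,ds.\end{aligned}$$
   Context: **Domain.** $L>0$, $\mathcal O=(0,L)$ with periodic boundary conditions, $T_{max}>0$ fixed. $E[u]:=\int_{\mathcal O}\frac12|u_x|^2+F(u)\,dx$; $\overline v=\frac1L\int_{\mathcal O}v\,dx$. **Standing assumptions.** (A1) $m(u)=u^n$ with $n\in(2,3)$. (A2) $F(u)=c_Fu^{-p}$ for $u>0$ with $c_F>0$ and some $p>n$; $F(u)=+\infty$ for $u\le0$. (A3) $\Lambda$ is a Borel probability measure on $H^1_{per}(\mathcal O)$ supported on strictly positive functions such that for some $C>0$: $\operatorname{esssup}_{v\in\operatorname{supp}\Lambda}\{E[\mathcal I_h[v]]+\int_{\mathcal O}v\,dx+(\int_{\mathcal O}v\,dx)^{-1}\}\le C$ for any $h>0$. (A4) $(\Omega,\mathcal F,(\mathcal F_t)_{t\ge0},\mathbb P)$ is a stochastic basis with complete, right-continuous filtration; $W=\sum_{\ell\in\mathbb Z}\lambda_\ell g_\ell\beta_\ell$ is an adapted $Q$-Wiener process, with independent standard Brownian motions $\beta_\ell$, numbers $\lambda_\ell\ge0$, $\lambda_\ell=\lambda_{-\ell}$, $\sum_{\ell}\ell^4\lambda_\ell^2<\infty$, and $g_\ell(x)=\sqrt{2/L}\sin(2\pi\ell x/L)$ for $\ell>0$, $g_0=1/\sqrt L$, $g_\ell(x)=\sqrt{2/L}\cos(2\pi\ell x/L)$ for $\ell<0$; there is an $\mathcal F_0$-measurable $u_0$ with $\Lambda=\mathbb P\circ u_0^{-1}$. (A5)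 With $C_{osc}:=1+\sqrt{2c_F}$ and $C_{Strat}:=\frac12\frac{n^2}{4}\big(\frac{\lambda_0^2}{L}+\sum_{\ell=1}^\infty\frac{2\lambda_\ell^2}{L}\big)$, the real parameter $S$ satisfies $S>C_{Strat}\frac{3C_{osc}^{4-n}}{(1+C_{osc})^{n-4}}\frac{n-2}{3-n}+C_{Strat}(C_{osc}^{n-2}-1)$. **Discretization.** $h\in(0,1)$ with $L_h:=L/h\in\mathbb N$. $X_h$: $L$-periodic continuous functions that are linear on each $[(i-1)h,ih]$; $e_i\in X_h$ the nodal basis function equal to $1$ at $ih$ and $0$ at the other nodes; $\mathcal I_h:C_{per}([0,L])\to X_h$ nodal interpolation; $v_i:=v(ih)$, indices periodic. $\partial_h^-f(x):=h^{-1}(f(x)-f(x-h))$ (periodic extension). $(\phi,\psi)_h:=h\sum_{i=1}^{L_h}\phi_i\psi_i$. $\Delta_hv^h\in X_h$ has nodal values $(v_{i+1}-2v_i+v_{i-1})/h^2$. For positive $u^h\in X_h$ and $v^h\in X_h$: $A^h_\Delta(u^h,v^h)=-\frac{n-2}{6}h\sum_i(u^h_i)^{n-3}\big(|\frac{u^h_i-u^h_{i-1}}h|^2+|\frac{u^h_{i+1}-u^h_i}h|^2\big)v^h_i-\frac{n-2}{6}h\sum_i\big\{((u^h_i)^{n-3}+(u^h_{i+1})^{n-3})\frac{u^h_{i+1}-u^h_i}{h}+((u^h_{i-1})^{n-3}+(u^h_i)^{n-3})\frac{u^h_i-u^h_{i-1}}{h}\big\}\frac{u^h_{i+1}-u^h_{i-1}}{2h}v^h_i$,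 $B^h_\Delta(u^h,v^h)=-h\sum_i(u^h_i)^{n-2}\frac{u^h_{i+1}-2u^h_i+u^h_{i-1}}{h^2}v^h_i$. With $\sigma:=\frac12h^{2/(p+2)}$ and $m_\sigma(u):=m(\max(\sigma,u))$, the discrete mobility $M_h(v^h)$ is elementwise constant: on $(ih,(i+1)h]$ it equals $m_\sigma(v_i^h)$ if $v^h_i=v^h_{i+1}$ and $\big(\frac{1}{v^h_{i+1}-v^h_i}\int_{v^h_i}^{v^h_{i+1}}\frac{ds}{m_\sigma(s)}\big)^{-1}$ otherwise. $M_2^h(u^h):=\mathcal I_h[|u^h|^{n/2}]$. $E_h[v]:=\int_{\mathcal O}\frac12|v_x|^2+\mathcal I_h[F(v)]\,dx$. **Scheme.** $N_h\in\mathbb N$ with $N_h\to\infty$ as $h\to0$, $u^h(0)=\mathcal I_h[u_0]$, $E_{max,h}=\frac12c_Fh^{-(p-2)/(p+2)}$. A solution is $u^h\in L^2(\Omega;C([0,T_{max}];X_h))$, $p^h\in L^2(\Omega;L^2((0,T_{max});X_h))$ with $\big\|\operatorname{esssup}_{t\in(0,T_{max})}\|p^h(t)\|_{X_h}\big\|_{L^2(\Omega)}<\infty$ such that for all $T\in[0,T_{max}]$, $\phi^h\in X_h$: $(u^h(T),\phi^h)_h=(u_0,\phi^h)_h-\int_0^{T\wedge T_h}\int_{\mathcal O}M_h(u^h)p^h_x\phi^h_x\,dx\,dt-(C_{Strat}+S)\int_0^{T\wedge T_h}\big(A^h_\Delta(u^h,\phi^h)+B^h_\Delta(u^h,\phi^h)\big)dt-\sum_{|\ell|\le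 N_h}\int_0^{T\wedge T_h}\int_{\mathcal O}\lambda_\ell M_2^h(u^h)g_\ell\phi^h_x\,dx\,d\beta_\ell$, $(p^h,\phi^h)_h=\chi_{T_h}\int_{\mathcal O}u^h_x\phi^h_x\,dx+\chi_{T_h}(F'(u^h),\phi^h)_h$. Here $\chi_{T_h}$ is the indicator of the time interval $[0,T_h]$ and $T_h:=T_h^E\wedge T_h^M$ with $T_h^E=T_{max}\wedge\inf\{t\ge0:E_h[u^h(t)]\ge E_{max,h}\}$, $T_h^M=T_{max}\wedge\inf\{t\ge0:|\overline{u^h}(t)-\overline{u^h}(0)|\ge\frac12\overline{u^h}(0)\}$. *)

theory Defs
  imports "HOL-Probability.Probability"
begin

text \<open>
  Functions on the torus \<open>\<O>\<close> of length \<open>L\<close> are \<open>L\<close>-periodic functions on the real line, and integrals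
  over \<open>\<O>\<close> are Lebesgue integrals over one period. Spatial derivatives of Sobolev or piecewise
  smooth functions are \<^const>\<open>deriv\<close>, which is the weak derivative almost everywhere; its values
  at the exceptional points do not affect any integral below.
\<close>

definition H1per :: "real \<Rightarrow> (real \<Rightarrow> real) set" where
  "H1per L = {v. (\<forall>x. v (x + L) = v x)
     \<and> set_integrable lborel {0..L} (deriv v)
     \<and> set_integrable lborel {0..L} (\<lambda>x. (deriv v x)\<^sup>2)
     \<and> (\<forall>x\<in>{0..L}. v x = v 0 + (LINT y:{0..x}|lborel. deriv v y))}"

definition H1_dist :: "real \<Rightarrow> (real \<Rightarrow> real) \<Rightarrow> (real \<Rightarrow> real) \<Rightarrow> real" where
  "H1_dist L v w =
     sqrt (LINT x:{0..L}|lborel. (v x - w x)\<^sup>2 + (deriv (\<lambda>y. v y - w y) x)\<^sup>2)"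

definition H1per_borel :: "real \<Rightarrow> (real \<Rightarrow> real) measure" where
  "H1per_borel L =
     sigma (H1per L) {U. openin (Metric_space.mtopology (H1per L) (H1_dist L)) U}"

definition admissible_mesh :: "real \<Rightarrow> real \<Rightarrow> bool" where
  "admissible_mesh L h \<longleftrightarrow> 0 < h \<and> h < 1 \<and> L / h \<in> \<nat>"

definition num_cells :: "real \<Rightarrow> real \<Rightarrow> int" where
  "num_cells L h = \<lfloor>L / h\<rfloor>"

definition Xh :: "real \<Rightarrow> real \<Rightarrow> (real \<Rightarrow> real) set" where
  "Xh L h = {v. continuous_on UNIV v \<and> (\<forall>x. v (x + L) = v x)
     \<and> (\<forall>i::int. \<exists>a b. \<forall>x\<in>{(of_int i - 1) * h..of_int i * h}. v x = a + b * x)}"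

definition nodal :: "real \<Rightarrow> (real \<Rightarrow> real) \<Rightarrow> int \<Rightarrow> real" where
  "nodal h v i = v (of_int i * h)"

definition pw_linear :: "real \<Rightarrow> (int \<Rightarrow> real) \<Rightarrow> real \<Rightarrow> real" where
  "pw_linear h a x =
     (1 - frac (x / h)) * a \<lfloor>x / h\<rfloor> + frac (x / h) * a (\<lfloor>x / h\<rfloor> + 1)"

definition nodal_interp :: "real \<Rightarrow> (real \<Rightarrow> real) \<Rightarrow> real \<Rightarrow> real" where
  "nodal_interp h v = pw_linear h (nodal h v)"

definition nodal_basis :: "real \<Rightarrow> real \<Rightarrow> int \<Rightarrow> real \<Rightarrow> real" where
  "nodal_basis L h i = pw_linear h (\<lambda>j. if num_cells L h dvd (j - i) then 1 else 0)"

text \<open>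
  The formula for \<^const>\<open>pw_linear\<close> gives the unique element of \<^const>\<open>Xh\<close> with prescribed periodic
  nodal values.
\<close>

lemma pw_linear_on_cell:
  assumes "h > 0" and x: "x \<in> {of_int k * h..(of_int k + 1) * h}"
  shows "pw_linear h a x = a k + (a (k + 1) - a k) * (x / h - of_int k)"
proof (cases "x = (of_int k + 1) * h")
  case True
  then have "x / h = of_int (k + 1)"
    using \<open>h > 0\<close> by simp
  then show ?thesis
    by (simp add: pw_linear_def algebra_simps)
next
  case False
  then have "of_int k \<le> x / h" "x / h < of_int k + 1"
    using assms by (auto simp: field_simps)
  then have "\<lfloor>x / h\<rfloor> = k"
    by linarith
  then show ?thesis
    by (simp add: pw_linear_def frac_def algebra_simps)
qed

lemma nodal_pw_linear: "h > 0 \<Longrightarrow> nodal h (pw_linear h a) i = a i"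
  by (simp add: nodal_def pw_linear_def)

lemma pw_linear_in_Xh:
  assumes mesh: "admissible_mesh L h" and per: "\<And>i. a (i + num_cells L h) = a i"
  shows "pw_linear h a \<in> Xh L h"
proof -
  have h: "h > 0" and N: "L / h = of_int (num_cells L h)"
    using mesh by (auto simp: admissible_mesh_def num_cells_def elim!: Nats_cases)
  have cell: "continuous_on {of_int k * h..(of_int k + 1) * h} (pw_linear h a)" for k :: int
    by (subst continuous_on_cong[OF refl pw_linear_on_cell[OF h]])
       (auto intro!: continuous_intros simp: h order_less_imp_not_eq2)
  have "isCont (pw_linear h a) x" for x
  proof -
    define k where "k = \<lfloor>x / h\<rfloor>"
    have "of_int k \<le> x / h" "x / h < of_int k + 1"
      unfolding k_def by linarith+
    then have x: "x \<in> {(of_int k - 1) * h<..<(of_int k + 1) * h}"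
      using h by (auto simp: field_simps)
    have "{(of_int k - 1) * h..(of_int k + 1) * h} =
        {of_int (k - 1) * h..(of_int (k - 1) + 1) * h} \<union> {of_int k * h..(of_int k + 1) * h}"
      using h by (auto simp: algebra_simps)
    then have "continuous_on {(of_int k - 1) * h..(of_int k + 1) * h} (pw_linear h a)"
      using continuous_on_closed_Un[OF _ _ cell[of "k - 1"] cell[of k]] by auto
    then have "continuous_on {(of_int k - 1) * h<..<(of_int k + 1) * h} (pw_linear h a)"
      by (rule continuous_on_subset) auto
    then show ?thesis
      using x by (simp add: continuous_on_eq_continuous_at)
  qed
  moreover have "pw_linear h a (x + L) = pw_linear h a x" for x
  proof -
    have "(x + L) / h = x / h + of_int (num_cells L h)"
      using N by (simp add: add_divide_distrib)
    then show ?thesis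
      using per[of "\<lfloor>x / h\<rfloor>"] per[of "\<lfloor>x / h\<rfloor> + 1"]
      by (simp add: pw_linear_def frac_def algebra_simps)
  qed
  moreover have "\<exists>c d. \<forall>x\<in>{(of_int i - 1) * h..of_int i * h}. pw_linear h a x = c + d * x"
    for i :: int
  proof (intro exI ballI)
    fix x assume "x \<in> {(of_int i - 1) * h..of_int i * h}"
    then show "pw_linear h a x =
        (a (i - 1) - (a i - a (i - 1)) * (of_int i - 1)) + ((a i - a (i - 1)) / h) * x"
      using pw_linear_on_cell[OF h, of x "i - 1" a] by (simp add: algebra_simps diff_divide_distrib)
  qed
  ultimately show ?thesis
    by (auto simp: Xh_def intro: continuous_at_imp_continuous_on)
qed

definition discrete_inner :: "real \<Rightarrow> real \<Rightarrow> (real \<Rightarrow> real) \<Rightarrow> (real \<Rightarrow> real) \<Rightarrow> real" where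
  "discrete_inner L h v w = h * (\<Sum>i=1..num_cells L h. nodal h v i * nodal h w i)"

definition Xh_norm :: "real \<Rightarrow> real \<Rightarrow> (real \<Rightarrow> real) \<Rightarrow> real" where
  "Xh_norm L h v = sqrt (discrete_inner L h v v)"

definition bdiff :: "real \<Rightarrow> (real \<Rightarrow> real) \<Rightarrow> real \<Rightarrow> real" where
  "bdiff h f x = (f x - f (x - h)) / h"

definition fquot :: "real \<Rightarrow> (real \<Rightarrow> real) \<Rightarrow> int \<Rightarrow> real" where
  "fquot h v i = (nodal h v (i + 1) - nodal h v i) / h"

definition bquot :: "real \<Rightarrow> (real \<Rightarrow> real) \<Rightarrow> int \<Rightarrow> real" where
  "bquot h v i = (nodal h v i - nodal h v (i - 1)) / h"

definition discrete_laplacian :: "real \<Rightarrow> (real \<Rightarrow> real) \<Rightarrow> real \<Rightarrow> real" where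
  "discrete_laplacian h v =
     pw_linear h (\<lambda>i. (nodal h v (i + 1) - 2 * nodal h v i + nodal h v (i - 1)) / h\<^sup>2)"

definition potential :: "real \<Rightarrow> real \<Rightarrow> real \<Rightarrow> ennreal" where
  "potential cF p u = (if u > 0 then ennreal (cF * u powr (- p)) else \<infinity>)"

definition potential_deriv :: "real \<Rightarrow> real \<Rightarrow> real \<Rightarrow> real" where
  "potential_deriv cF p u = deriv (\<lambda>s. enn2real (potential cF p s)) u"

definition mean :: "real \<Rightarrow> (real \<Rightarrow> real) \<Rightarrow> real" where
  "mean L v = (LINT x:{0..L}|lborel. v x) / L"

definition energy :: "real \<Rightarrow> real \<Rightarrow> real \<Rightarrow> (real \<Rightarrow> real) \<Rightarrow> ennreal" where
  "energy L cF p v =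
     (\<integral>\<^sup>+x\<in>{0..L}. (ennreal ((deriv v x)\<^sup>2 / 2) + potential cF p (v x)) \<partial>lborel)"

text \<open>
  Since the potential may be infinite, its nodal interpolant is expanded in the nodal basis.
\<close>

definition discrete_energy :: "real \<Rightarrow> real \<Rightarrow> real \<Rightarrow> real \<Rightarrow> (real \<Rightarrow> real) \<Rightarrow> ennreal" where
  "discrete_energy L cF p h v =
     (\<integral>\<^sup>+x\<in>{0..L}. (ennreal ((deriv v x)\<^sup>2 / 2)
        + (\<Sum>i=1..num_cells L h. potential cF p (nodal h v i) * ennreal (nodal_basis L h i x)))
      \<partial>lborel)"

definition initial_law :: "real \<Rightarrow> real \<Rightarrow> real \<Rightarrow> (real \<Rightarrow> real) measure \<Rightarrow> bool" where
  "initial_law L cF p Lam \<longleftrightarrow>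
     prob_space Lam \<and> space Lam = H1per L \<and> sets Lam = sets (H1per_borel L)
     \<and> (AE v in Lam. \<forall>x. v x > 0)
     \<and> (\<exists>C>0. \<forall>h. admissible_mesh L h \<longrightarrow>
          esssup Lam (\<lambda>v. energy L cF p (nodal_interp h v)
             + ennreal (LINT x:{0..L}|lborel. v x)
             + ennreal (inverse (LINT x:{0..L}|lborel. v x))) \<le> ennreal C)"

text \<open>
  A filtration indexed by nonnegative times is extended (for instance constantly) to negative
  indices in order to use the library locale.
\<close>

definition stochastic_basis :: "'w measure \<Rightarrow> (real \<Rightarrow> 'w measure) \<Rightarrow> bool" where
  "stochastic_basis M F \<longleftrightarrow>
     prob_space M \<and> filtration (space M) F \<and> (\<forall>t\<ge>0. subalgebra M (F t))
     \<and> (\<forall>A\<in>null_sets M. \<forall>B\<subseteq>A. B \<in> sets (F 0))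
     \<and> (\<forall>t\<ge>0. sets (F t) = (\<Inter>s\<in>{t<..}. sets (F s)))"

definition brownian_motion ::
  "'w measure \<Rightarrow> (real \<Rightarrow> 'w measure) \<Rightarrow> (real \<Rightarrow> 'w \<Rightarrow> real) \<Rightarrow> bool" where
  "brownian_motion M F b \<longleftrightarrow>
     (AE \<omega> in M. b 0 \<omega> = 0)
     \<and> (AE \<omega> in M. continuous_on {0..} (\<lambda>t. b t \<omega>))
     \<and> (\<forall>t\<ge>0. b t \<in> borel_measurable (F t))
     \<and> (\<forall>s\<ge>0. \<forall>t>s.
          distributed M lborel (\<lambda>\<omega>. b t \<omega> - b s \<omega>)
            (\<lambda>x. ennreal (normal_density 0 (sqrt (t - s)) x))
          \<and> prob_space.indep_set M (sets (F s))
              {(\<lambda>\<omega>. b t \<omega> - b s \<omega>) -` A \<inter> space M | A. A \<in> sets borel})"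

definition noise_mode :: "real \<Rightarrow> int \<Rightarrow> real \<Rightarrow> real" where
  "noise_mode L l x =
     (if l > 0 then sqrt (2 / L) * sin (2 * pi * of_int l * x / L)
      else if l = 0 then 1 / sqrt L
      else sqrt (2 / L) * cos (2 * pi * of_int l * x / L))"

definition Q_wiener_process ::
  "real \<Rightarrow> 'w measure \<Rightarrow> (real \<Rightarrow> 'w measure) \<Rightarrow> (int \<Rightarrow> real) \<Rightarrow> (int \<Rightarrow> real \<Rightarrow> 'w \<Rightarrow> real)
    \<Rightarrow> (real \<Rightarrow> 'w \<Rightarrow> real \<Rightarrow> real) \<Rightarrow> bool" where
  "Q_wiener_process L M F lam \<beta> W \<longleftrightarrow>
     (\<forall>l. lam l \<ge> 0) \<and> (\<forall>l. lam (- l) = lam l)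
     \<and> (\<lambda>l. of_int l ^ 4 * (lam l)\<^sup>2) summable_on UNIV
     \<and> (\<forall>l. brownian_motion M F (\<beta> l))
     \<and> prob_space.indep_vars M (\<lambda>l::int. PiM {0..} (\<lambda>t::real. borel))
         (\<lambda>l \<omega>. \<lambda>t\<in>{0..}. \<beta> l t \<omega>) UNIV
     \<and> (\<forall>t\<ge>0. AE \<omega> in M. \<forall>x. ((\<lambda>l. lam l * noise_mode L l x * \<beta> l t \<omega>) has_sum W t \<omega> x) UNIV)"

text \<open>
  The scalar Ito integral over \<open>[0, T]\<close> of a process that is almost surely square integrable in
  time: the limit in probability of integrals of bounded adapted step processes that approximate
  the integrand in \<open>L\<^sup>2(0, T)\<close>, in probability. Such an approximation exists exactly when the
  integrand agrees almost everywhere with a progressively measurable process.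
\<close>

definition simple_process ::
  "(real \<Rightarrow> 'w measure) \<Rightarrow> real \<Rightarrow> nat \<Rightarrow> (nat \<Rightarrow> real) \<Rightarrow> (nat \<Rightarrow> 'w \<Rightarrow> real) \<Rightarrow> bool" where
  "simple_process F T k r \<xi> \<longleftrightarrow>
     0 \<le> r 0 \<and> r k \<le> T \<and> (\<forall>j<k. r j \<le> r (Suc j))
     \<and> (\<forall>j<k. \<xi> j \<in> borel_measurable (F (r j)) \<and> bounded (\<xi> j ` space (F (r j))))"

definition simple_value ::
  "nat \<Rightarrow> (nat \<Rightarrow> real) \<Rightarrow> (nat \<Rightarrow> 'w \<Rightarrow> real) \<Rightarrow> real \<Rightarrow> 'w \<Rightarrow> real" where
  "simple_value k r \<xi> s \<omega> = (\<Sum>j<k. \<xi> j \<omega> * indicator {r j<..r (Suc j)} s)"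

definition simple_integral ::
  "(real \<Rightarrow> 'w \<Rightarrow> real) \<Rightarrow> nat \<Rightarrow> (nat \<Rightarrow> real) \<Rightarrow> (nat \<Rightarrow> 'w \<Rightarrow> real) \<Rightarrow> 'w \<Rightarrow> real" where
  "simple_integral b k r \<xi> \<omega> = (\<Sum>j<k. \<xi> j \<omega> * (b (r (Suc j)) \<omega> - b (r j) \<omega>))"

definition is_ito_integral ::
  "'w measure \<Rightarrow> (real \<Rightarrow> 'w measure) \<Rightarrow> (real \<Rightarrow> 'w \<Rightarrow> real) \<Rightarrow> real \<Rightarrow> (real \<Rightarrow> 'w \<Rightarrow> real)
    \<Rightarrow> ('w \<Rightarrow> real) \<Rightarrow> bool" where
  "is_ito_integral M F b T X J \<longleftrightarrow>
     (\<lambda>(\<omega>, s). X s \<omega>) \<in> borel_measurable (M \<Otimes>\<^sub>M restrict_space lborel {0..T})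
     \<and> (AE \<omega> in M. (\<integral>\<^sup>+s\<in>{0..T}. ennreal ((X s \<omega>)\<^sup>2) \<partial>lborel) < \<infinity>)
     \<and> J \<in> borel_measurable M
     \<and> (\<exists>k r \<xi>. (\<forall>m::nat. simple_process F T (k m) (r m) (\<xi> m))
          \<and> (\<forall>e>0. (\<lambda>m. measure M {\<omega> \<in> space M. ennreal e <
                (\<integral>\<^sup>+s\<in>{0..T}. ennreal ((simple_value (k m) (r m) (\<xi> m) s \<omega> - X s \<omega>)\<^sup>2) \<partial>lborel)})
              \<longlonglongrightarrow> 0)
          \<and> (\<forall>e>0. (\<lambda>m. measure M {\<omega> \<in> space M. e <
                \<bar>simple_integral b (k m) (r m) (\<xi> m) \<omega> - J \<omega>\<bar>}) \<longlonglongrightarrow> 0))"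

definition C_osc :: "real \<Rightarrow> real" where
  "C_osc cF = 1 + sqrt (2 * cF)"

definition C_Strat :: "real \<Rightarrow> real \<Rightarrow> (int \<Rightarrow> real) \<Rightarrow> real" where
  "C_Strat L n lam =
     1/2 * (n\<^sup>2 / 4) * ((lam 0)\<^sup>2 / L + (\<Sum>\<^sub>\<infinity>l\<in>{1..}. 2 * (lam l)\<^sup>2 / L))"

definition mob_trunc :: "real \<Rightarrow> real \<Rightarrow> real \<Rightarrow> real" where
  "mob_trunc n \<sigma> u = (max \<sigma> u) powr n"

definition mesh_sigma :: "real \<Rightarrow> real \<Rightarrow> real" where
  "mesh_sigma p h = 1/2 * h powr (2 / (p + 2))"

text \<open>
  The index \<open>\<lceil>x / h\<rceil> - 1\<close> is the \<open>i\<close> with \<open>x\<close> in the half-open cell \<open>(i h, (i + 1) h]\<close>; the interval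
  integral is oriented.
\<close>

definition discrete_mobility :: "real \<Rightarrow> real \<Rightarrow> real \<Rightarrow> (real \<Rightarrow> real) \<Rightarrow> real \<Rightarrow> real" where
  "discrete_mobility n p h v x =
     (let i = \<lceil>x / h\<rceil> - 1; a = nodal h v i; b = nodal h v (i + 1); \<sigma> = mesh_sigma p h
      in if a = b then mob_trunc n \<sigma> a
         else inverse ((LBINT s=ereal a..ereal b. inverse (mob_trunc n \<sigma> s)) / (b - a)))"

definition M2h :: "real \<Rightarrow> real \<Rightarrow> (real \<Rightarrow> real) \<Rightarrow> real \<Rightarrow> real" where
  "M2h n h v = nodal_interp h (\<lambda>x. \<bar>v x\<bar> powr (n / 2))"

definition A_Delta :: "real \<Rightarrow> real \<Rightarrow> real \<Rightarrow> (real \<Rightarrow> real) \<Rightarrow> (real \<Rightarrow> real) \<Rightarrow> real" where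
  "A_Delta L n h u v =
     - ((n - 2) / 6) * h * (\<Sum>i=1..num_cells L h.
          nodal h u i powr (n - 3) * (\<bar>bquot h u i\<bar>\<^sup>2 + \<bar>fquot h u i\<bar>\<^sup>2) * nodal h v i)
     - ((n - 2) / 6) * h * (\<Sum>i=1..num_cells L h.
          ((nodal h u i powr (n - 3) + nodal h u (i + 1) powr (n - 3)) * fquot h u i
           + (nodal h u (i - 1) powr (n - 3) + nodal h u i powr (n - 3)) * bquot h u i)
          * ((nodal h u (i + 1) - nodal h u (i - 1)) / (2 * h)) * nodal h v i)"

definition B_Delta :: "real \<Rightarrow> real \<Rightarrow> real \<Rightarrow> (real \<Rightarrow> real) \<Rightarrow> (real \<Rightarrow> real) \<Rightarrow> real" where
  "B_Delta L n h u v =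
     - h * (\<Sum>i=1..num_cells L h. nodal h u i powr (n - 2)
          * ((nodal h u (i + 1) - 2 * nodal h u i + nodal h u (i - 1)) / h\<^sup>2) * nodal h v i)"

definition E_max :: "real \<Rightarrow> real \<Rightarrow> real \<Rightarrow> real" where
  "E_max cF p h = 1/2 * cF * h powr (- ((p - 2) / (p + 2)))"

text \<open>
  The stopping times act on one path, given as a function of time and space on \<open>[0, T\<^sub>m\<^sub>a\<^sub>x]\<close>;
  inserting the final time into the set realizes the minimum with the final time, also when the
  hitting set is empty.
\<close>

definition stop_energy ::
  "real \<Rightarrow> real \<Rightarrow> real \<Rightarrow> real \<Rightarrow> real \<Rightarrow> (real \<Rightarrow> real \<Rightarrow> real) \<Rightarrow> real" where
  "stop_energy L Tmax cF p h w =
     Inf (insert Tmax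
       {t\<in>{0..Tmax}. discrete_energy L cF p h (w t) \<ge> ennreal (E_max cF p h)})"

definition stop_mass :: "real \<Rightarrow> real \<Rightarrow> (real \<Rightarrow> real \<Rightarrow> real) \<Rightarrow> real" where
  "stop_mass L Tmax w =
     Inf (insert Tmax {t\<in>{0..Tmax}. \<bar>mean L (w t) - mean L (w 0)\<bar> \<ge> 1/2 * mean L (w 0)})"

definition stop_time ::
  "real \<Rightarrow> real \<Rightarrow> real \<Rightarrow> real \<Rightarrow> real \<Rightarrow> (real \<Rightarrow> real \<Rightarrow> real) \<Rightarrow> real" where
  "stop_time L Tmax cF p h w = min (stop_energy L Tmax cF p h w) (stop_mass L Tmax w)"

text \<open>
  The spaces of path-valued random variables are spelled out: since \<^const>\<open>Xh\<close> is finite-dimensional,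
  measurability amounts to measurability of all evaluations.
\<close>

definition L2_C_Xh ::
  "'w measure \<Rightarrow> real \<Rightarrow> real \<Rightarrow> real \<Rightarrow> ('w \<Rightarrow> real \<Rightarrow> real \<Rightarrow> real) \<Rightarrow> bool" where
  "L2_C_Xh M Tmax L h u \<longleftrightarrow>
     (\<forall>\<omega>\<in>space M. \<forall>t\<in>{0..Tmax}. u \<omega> t \<in> Xh L h
        \<and> ((\<lambda>s. Xh_norm L h (\<lambda>x. u \<omega> s x - u \<omega> t x)) \<longlongrightarrow> 0) (at t within {0..Tmax}))
     \<and> (\<forall>t\<in>{0..Tmax}. \<forall>x. (\<lambda>\<omega>. u \<omega> t x) \<in> borel_measurable M)
     \<and> (\<integral>\<^sup>+\<omega>. (SUP t\<in>{0..Tmax}. ennreal (Xh_norm L h (u \<omega> t)))\<^sup>2 \<partial>M) < \<infinity>"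

definition L2_L2_Xh ::
  "'w measure \<Rightarrow> real \<Rightarrow> real \<Rightarrow> real \<Rightarrow> ('w \<Rightarrow> real \<Rightarrow> real \<Rightarrow> real) \<Rightarrow> bool" where
  "L2_L2_Xh M Tmax L h q \<longleftrightarrow>
     (\<forall>\<omega>\<in>space M. \<forall>t\<in>{0<..<Tmax}. q \<omega> t \<in> Xh L h)
     \<and> (\<forall>x. (\<lambda>(\<omega>, t). q \<omega> t x)
            \<in> borel_measurable (M \<Otimes>\<^sub>M restrict_space lborel {0<..<Tmax}))
     \<and> (\<integral>\<^sup>+\<omega>. (\<integral>\<^sup>+t\<in>{0<..<Tmax}. ennreal ((Xh_norm L h (q \<omega> t))\<^sup>2) \<partial>lborel) \<partial>M) < \<infinity>"

text \<open>
  In the first equation of the scheme, the Ito integral up to the minimum of \<open>T\<close> and the stopping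
  time is the integral over \<open>[0, T]\<close> of the integrand cut off after the stopping time.
\<close>

definition scheme_solution ::
  "real \<Rightarrow> real \<Rightarrow> real \<Rightarrow> real \<Rightarrow> real \<Rightarrow> real \<Rightarrow> 'w measure \<Rightarrow> (real \<Rightarrow> 'w measure)
    \<Rightarrow> (int \<Rightarrow> real) \<Rightarrow> (int \<Rightarrow> real \<Rightarrow> 'w \<Rightarrow> real) \<Rightarrow> (real \<Rightarrow> nat) \<Rightarrow> ('w \<Rightarrow> real \<Rightarrow> real) \<Rightarrow> real
    \<Rightarrow> ('w \<Rightarrow> real \<Rightarrow> real \<Rightarrow> real) \<Rightarrow> ('w \<Rightarrow> real \<Rightarrow> real \<Rightarrow> real) \<Rightarrow> bool" where
  "scheme_solution L Tmax n p cF S M F lam \<beta> N u0 h u q \<longleftrightarrow>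
     L2_C_Xh M Tmax L h u \<and> L2_L2_Xh M Tmax L h q
     \<and> (\<integral>\<^sup>+\<omega>. (esssup (restrict_space lborel {0<..<Tmax})
                  (\<lambda>t. ennreal (Xh_norm L h (q \<omega> t))))\<^sup>2 \<partial>M) < \<infinity>
     \<and> (AE \<omega> in M. u \<omega> 0 = nodal_interp h (u0 \<omega>))
     \<and> (\<forall>T\<in>{0..Tmax}. \<forall>\<phi>\<in>Xh L h. \<exists>J.
          (\<forall>l\<in>{- int (N h)..int (N h)}. is_ito_integral M F (\<beta> l) T
             (\<lambda>s \<omega>. indicator {0..stop_time L Tmax cF p h (u \<omega>)} s *
                (LINT x:{0..L}|lborel.
                   lam l * M2h n h (u \<omega> s) x * noise_mode L l x * deriv \<phi> x)) (J l))
          \<and> (AE \<omega> in M.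
               discrete_inner L h (u \<omega> T) \<phi> =
                 discrete_inner L h (u0 \<omega>) \<phi>
                 - (LINT s:{0..min T (stop_time L Tmax cF p h (u \<omega>))}|lborel.
                      LINT x:{0..L}|lborel.
                        discrete_mobility n p h (u \<omega> s) x * deriv (q \<omega> s) x * deriv \<phi> x)
                 - (C_Strat L n lam + S) *
                   (LINT s:{0..min T (stop_time L Tmax cF p h (u \<omega>))}|lborel.
                      A_Delta L n h (u \<omega> s) \<phi> + B_Delta L n h (u \<omega> s) \<phi>)
                 - (\<Sum>l=- int (N h)..int (N h). J l \<omega>)))
     \<and> (AE \<omega> in M. AE t in lborel. t \<in> {0<..<Tmax} \<longrightarrow> (\<forall>\<phi>\<in>Xh L h.
          discrete_inner L h (q \<omega> t) \<phi> =
            indicator {0..stop_time L Tmax cF p h (u \<omega>)} t *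
              (LINT x:{0..L}|lborel. deriv (u \<omega> t) x * deriv \<phi> x)
            + indicator {0..stop_time L Tmax cF p h (u \<omega>)} t *
              discrete_inner L h (\<lambda>x. potential_deriv cF p (u \<omega> t x)) \<phi>))"

end

theory Submission
  imports Defs
begin

text \<open>
  Testing the difference quotient of \<open>(M\<^sub>2 g\<^sub>l)\<^sub>x\<close> with a hat function amounts to an integration by
  parts on each cell: the result is \<open>1 / h\<^sup>2\<close> times the second difference of the cell integrals of
  \<open>M\<^sub>2 g\<^sub>l\<close> (\<open>flux_against_basis\<close>). In this second difference a discrete product rule separates the
  leading part, where both differences fall on the nodal values \<open>u\<^sub>i powr (n/2)\<close> of the mobility
  factor, from a remainder in which at least one difference falls on the mode \<open>g\<^sub>l\<close>. Young's
  inequality with parameter \<open>\<eta>\<close> separates the squares.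

  The sum over the modes is taken pointwise in space. As \<open>sin\<^sup>2 + cos\<^sup>2 = 1\<close> and the weights are
  symmetric, the modes \<open>l\<close> and \<open>-l\<close> together contribute a constant, so the leading part carries
  the constant \<open>\<Sum>\<^sub>l \<lambda>\<^sub>l\<^sup>2 g\<^sub>l\<^sup>2 = 8 C\<^sub>S\<^sub>t\<^sub>r\<^sub>a\<^sub>t / n\<^sup>2\<close>. Differences of \<open>g\<^sub>l\<close> cost at most a factor \<open>l\<^sup>2\<close>, and
  \<open>\<Sum>\<^sub>l l\<^sup>4 \<lambda>\<^sub>l\<^sup>2\<close> is finite; the remainder therefore yields the terms with the two constants that
  depend on \<open>\<eta>\<close>. All this is collected in \<open>noise_flux_mode_sum_le\<close>.

  It remains to express second differences of \<open>u powr (n/2)\<close> through those of \<open>u\<close>. Taylor's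
  formula gives \<open>(n/2) u powr (n/2 - 1)\<close> times the second difference of \<open>u\<close>, plus a quadratic
  expression in the slopes whose coefficient is evaluated at intermediate points; a second
  application of Young's inequality, now with \<open>\<epsilon> (n - 2) / 2\<close>, leads to the two terms in the
  braces (\<open>powr_second_difference\<close>). The intermediate values are comparable to \<open>u\<^sub>i\<close> because
  neighbouring nodal values differ at most by the factor \<open>C\<^sub>o\<^sub>s\<^sub>c\<close>: up to the stopping time the
  discrete energy stays below its threshold, whose potential part bounds the nodal values from
  below by \<open>h powr (2 / (p + 2))\<close> and whose gradient part bounds their increments by \<open>sqrt c\<^sub>F\<close> times
  the same quantity (\<open>path_up_to_stopping_time\<close>).

  These bounds hold at each time. All integrands are continuous in time up to the stopping time,
  hence integrable, and the inequality may be integrated for every finite set of modes. Since all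
  contributions are nonnegative, both summability and the bound for the full sum follow.
\<close>

section \<open>Sums of periodic sequences\<close>

lemma sum_periodic_shift:
  fixes f :: "int \<Rightarrow> 'a::comm_monoid_add"
  assumes "\<And>i. f (i + N) = f i"
  shows "(\<Sum>i=1..N. f (i + 1)) = (\<Sum>i=1..N. f i)"
proof (cases "N \<ge> 1")
  case True
  have "(\<Sum>i=1..N. f (i + 1)) = (\<Sum>i=2..N+1. f i)"
    by (rule sum.reindex_bij_witness[of _ "\<lambda>i. i - 1" "\<lambda>i. i + 1"]) auto
  also have "{2..N+1} = insert (N + 1) {2..N}" using True by auto
  also have "(\<Sum>i\<in>insert (N + 1) {2..N}. f i) = f (1 + N) + (\<Sum>i=2..N. f i)"
    by (simp add: add.commute)
  also have "\<dots> = (\<Sum>i\<in>insert 1 {2..N}. f i)" by (simp add: assms)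
  also have "insert 1 {2..N} = {1..N}" using True by auto
  finally show ?thesis .
qed auto

lemma periodic_multiple:
  fixes f :: "int \<Rightarrow> 'a"
  assumes "\<And>i. f (i + N) = f i"
  shows "f (i + k * N) = f i"
proof (induction k rule: int_induct[where k = 0])
  case (step1 k)
  then show ?case using assms[of "i + k * N"] by (simp add: algebra_simps)
next
  case (step2 k)
  then show ?case using assms[of "i + (k - 1) * N"] by (simp add: algebra_simps)
qed simp

lemma periodic_all:
  fixes f :: "int \<Rightarrow> 'a"
  assumes per: "\<And>i. f (i + N) = f i" and N: "N \<ge> 1" and P: "\<And>i. i \<in> {c..<c + N} \<Longrightarrow> P (f i)"
  shows "P (f i)"
proof -
  let ?r = "(i - c) mod N + c"
  have "?r \<in> {c..<c + N}" using N by auto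
  moreover have "f i = f ?r"
  proof -
    have "i = ?r + ((i - c) div N) * N" using div_mult_mod_eq[of "i - c" N] by linarith
    then show ?thesis using periodic_multiple[of f N, OF per, of ?r "(i - c) div N"] by simp
  qed
  ultimately show ?thesis using P by simp
qed

lemma sum_periodic_delta:
  fixes f :: "int \<Rightarrow> real"
  assumes per: "\<And>i. f (i + N) = f i" and N: "N \<ge> 1"
  shows "(\<Sum>k=1..N. (if N dvd k - j then 1 else 0) * f k) = f j"
proof -
  define r where "r = (j - 1) mod N + 1"
  have j: "j = r + ((j - 1) div N) * N"
    unfolding r_def using div_mult_mod_eq[of "j - 1" N] by linarith
  have r: "r \<in> {1..N}" using N by (auto simp: r_def intro: pos_mod_bound zless_imp_add1_zle)
  have shift: "N dvd k - j \<longleftrightarrow> N dvd k - r" for k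
  proof -
    have *: "k - r = (k - j) + ((j - 1) div N) * N" using j by linarith
    show ?thesis unfolding * by simp
  qed
  have "N dvd k - j \<longleftrightarrow> k = r" if "k \<in> {1..N}" for k
  proof
    assume "N dvd k - j"
    then show "k = r" using shift[of k] r that zdvd_imp_le[of N "\<bar>k - r\<bar>"] by (cases "k = r") auto
  next
    assume "k = r"
    then show "N dvd k - j" using shift[of k] by simp
  qed
  then have "(\<Sum>k=1..N. (if N dvd k - j then 1 else 0) * f k) = (\<Sum>k=1..N. if k = r then f k else 0)"
    by (intro sum.cong) auto
  also have "\<dots> = f r" using r by simp
  also have "\<dots> = f j" using periodic_multiple[of f N, OF per, of r "(j - 1) div N"] j by simp
  finally show ?thesis .
qed

section \<open>Integration by parts on the cells\<close>

lemma mesh_cells: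
  assumes "admissible_mesh L h"
  shows "h > 0" "L = of_int (num_cells L h) * h" "L > 0 \<Longrightarrow> num_cells L h \<ge> 1"
proof -
  show h: "h > 0" using assms by (simp add: admissible_mesh_def)
  have "L / h = of_int (num_cells L h)"
    using assms by (auto simp: admissible_mesh_def num_cells_def elim!: Nats_cases)
  with h show L: "L = of_int (num_cells L h) * h" by (simp add: field_simps)
  show "num_cells L h \<ge> 1" if "L > 0"
  proof (rule ccontr)
    assume "\<not> ?thesis"
    then have "num_cells L h \<le> 0" by simp
    then have "of_int (num_cells L h) * h \<le> 0" using h by (simp add: mult_nonpos_nonneg)
    with L that show False by simp
  qed
qed


lemma integral_by_cells:
  fixes f :: "real \<Rightarrow> real"
  assumes h: "h > 0" and N: "N \<ge> 0"
    and int: "\<And>k::int. set_integrable lborel {of_int k * h..(of_int k + 1) * h} f"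
    and J: "\<And>k::int. (LINT x:{of_int k * h..(of_int k + 1) * h}|lborel. f x) = J k"
  shows "set_integrable lborel {0..of_int N * h} f
     \<and> (LINT x:{0..of_int N * h}|lborel. f x) = (\<Sum>k=1..N. J (k - 1))"
  using N
proof (induction N rule: int_ge_induct)
  case base
  have "(LINT x:{0}|lborel. f x) = 0" by (simp add: set_integral_at_point[OF set_borel_integrable_singleton])
  then show ?case by (simp add: set_borel_integrable_singleton)
next
  case (step N)
  have split: "{0..of_int (N + 1) * h} = {0..of_int N * h} \<union> {of_int N * h..(of_int N + 1) * h}"
  proof -
    have "0 \<le> of_int N * h" using h step.hyps by simp
    moreover have "of_int (N + 1) * h = of_int N * h + h" by (simp add: algebra_simps)
    ultimately show ?thesis using h by (auto simp: algebra_simps)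
  qed
  have "AE x in lborel. x \<noteq> of_int N * h" by (rule AE_lborel_singleton)
  then have "AE x in lborel. \<not> (x \<in> {0..of_int N * h} \<and> x \<in> {of_int N * h..(of_int N + 1) * h})"
    by eventually_elim auto
  then have "(LINT x:{0..of_int (N + 1) * h}|lborel. f x) = (\<Sum>k=1..N. J (k - 1)) + J N"
    unfolding split using step.IH int[of N] J[of N] by (subst set_integral_Un_AE) auto
  moreover have "set_integrable lborel {0..of_int (N + 1) * h} f"
    unfolding split using step.IH int[of N] by (intro set_integrable_Un) auto
  moreover have "{1..N + 1} = insert (N + 1) {1..N}" using step.hyps by auto
  ultimately show ?case by simp
qed

lemma integral_on_cell:
  fixes f \<phi> :: "real \<Rightarrow> real" and k :: int
  assumes h: "h > 0" and \<phi>: "continuous_on {0..1} \<phi>"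
    and f: "\<And>x. of_int k * h < x \<Longrightarrow> x < (of_int k + 1) * h \<Longrightarrow> f x = \<phi> (x / h - of_int k)"
  shows "set_integrable lborel {of_int k * h..(of_int k + 1) * h} f
    \<and> (LINT x:{of_int k * h..(of_int k + 1) * h}|lborel. f x) = h * integral {0..1} \<phi>"
proof
  let ?a = "of_int k * h" and ?b = "(of_int k + 1) * h" and ?f = "\<lambda>x. \<phi> (x / h - of_int k)"
  have ab: "?a \<le> ?b" using h by simp
  have "continuous_on {?a..?b} ?f"
    using h by (intro continuous_on_compose2[OF \<phi>] continuous_intros) (auto simp: field_simps)
  then have "set_integrable lborel {?a..?b} ?f"
    by (rule borel_integrable_atLeastAtMost')
  then have "set_integrable lborel {?a<..<?b} ?f"
    by (rule set_integrable_subset) auto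
  then have "set_integrable lborel {?a<..<?b} f"
    by (subst (asm) set_integrable_cong[where f' = f]) (auto simp: f)
  then have "set_integrable lborel ({?a<..<?b} \<union> ({?a} \<union> {?b})) f"
    by (intro set_integrable_Un set_borel_integrable_singleton) auto
  also have "{?a<..<?b} \<union> ({?a} \<union> {?b}) = {?a..?b}" using ab by auto
  finally show int: "set_integrable lborel {?a..?b} f" .
  have "(\<phi> has_integral integral {0..1} \<phi>) (cbox 0 1)"
    using integrable_integral[OF integrable_continuous_real[OF \<phi>]] by simp
  from has_integral_affinity'[OF this, of "1/h" "- of_int k"] h
  have "(?f has_integral (h * integral {0..1} \<phi>)) {?a..?b}"
    by (simp add: divide_simps algebra_simps)
  then have "(f has_integral (h * integral {0..1} \<phi>)) {?a..?b}"
    by (rule has_integral_spike_finite[of "{?a, ?b}", rotated 2]) (auto simp: f)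
  then show "(LINT x:{?a..?b}|lborel. f x) = h * integral {0..1} \<phi>"
    using set_borel_integral_eq_integral(2)[OF int] by (simp add: integral_unique)
qed

text \<open>
  Functions such as derivatives of piecewise smooth functions are only specified inside the cells;
  on each cell they are described by a function \<open>\<phi> k\<close> of the relative position in \<open>[0, 1]\<close>.
\<close>

lemma integral_over_period:
  fixes f :: "real \<Rightarrow> real" and \<phi> :: "int \<Rightarrow> real \<Rightarrow> real"
  assumes mesh: "admissible_mesh L h" and L: "L > 0"
    and \<phi>: "\<And>k. continuous_on {0..1} (\<phi> k)"
    and f: "\<And>k x. of_int k * h < x \<Longrightarrow> x < (of_int k + 1) * h \<Longrightarrow> f x = \<phi> k (x / h - of_int k)"
  shows "(LINT x:{0..L}|lborel. f x) = h * (\<Sum>k=1..num_cells L h. integral {0..1} (\<phi> (k - 1)))"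
proof -
  note m = mesh_cells[OF mesh]
  have "set_integrable lborel {of_int k * h..(of_int k + 1) * h} f
    \<and> (LINT x:{of_int k * h..(of_int k + 1) * h}|lborel. f x) = h * integral {0..1} (\<phi> k)" for k
    by (rule integral_on_cell[OF m(1) \<phi> f])
  with integral_by_cells[of h "num_cells L h" f "\<lambda>k. h * integral {0..1} (\<phi> k)"] m(1) m(3)[OF L]
  show ?thesis by (simp add: m(2)[symmetric] sum_distrib_left)
qed

text \<open>
  The product of the piecewise linear function with nodal values \<open>a\<close> and of \<open>g\<close>, on cell \<open>k\<close> as a
  function of the relative position.
\<close>

definition cell_product :: "real \<Rightarrow> (int \<Rightarrow> real) \<Rightarrow> (real \<Rightarrow> real) \<Rightarrow> int \<Rightarrow> real \<Rightarrow> real" where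
  "cell_product h a g k y = ((1 - y) * a k + y * a (k + 1)) * g ((of_int k + y) * h)"

lemma pw_linear_inside_cell:
  assumes "h > 0" "of_int k * h < x" "x < (of_int k + 1) * h"
  shows "pw_linear h a x = (1 - (x / h - of_int k)) * a k + (x / h - of_int k) * a (k + 1)"
  using assms by (subst pw_linear_on_cell[where k = k]) (auto simp: algebra_simps)

lemma deriv_inside_cell:
  assumes h: "h > 0" and x: "of_int k * h < x" "x < (of_int k + 1) * h"
    and g: "\<And>x. (g has_real_derivative g' x) (at x)"
  shows "deriv (\<lambda>y. pw_linear h a y * g y) x
    = (a (k + 1) - a k) / h * g x + ((1 - (x / h - of_int k)) * a k + (x / h - of_int k) * a (k + 1)) * g' x"
proof (rule DERIV_imp_deriv)
  let ?w = "\<lambda>y. ((1 - (y / h - of_int k)) * a k + (y / h - of_int k) * a (k + 1)) * g y"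
  have "(?w has_real_derivative (a (k + 1) - a k) / h * g x
      + ((1 - (x / h - of_int k)) * a k + (x / h - of_int k) * a (k + 1)) * g' x) (at x)"
    using h by (auto intro!: derivative_eq_intros g simp: field_simps)
  then show "((\<lambda>y. pw_linear h a y * g y) has_real_derivative (a (k + 1) - a k) / h * g x
      + ((1 - (x / h - of_int k)) * a k + (x / h - of_int k) * a (k + 1)) * g' x) (at x)"
    by (rule has_field_derivative_transform_within_open[of _ _ _ "{of_int k * h<..<(of_int k + 1) * h}"])
       (use x in \<open>auto simp: pw_linear_inside_cell[OF h]\<close>)
qed

text \<open>
  The hat function is \<open>y\<close> on the cell to the left of its node and \<open>1 - y\<close> on the cell to the right,
  so integration by parts turns \<open>\<psi>' y\<close> and \<open>\<psi>' (1 - y)\<close> into cell integrals of \<open>\<psi>\<close> and nodal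
  values. The nodal values cancel because \<open>\<psi>\<close> is continuous across the nodes, and what is left is a
  second difference of cell integrals. Working with nodal values indexed by the integers and periodic,
  the argument covers meshes with one or two cells as well.
\<close>

lemma flux_against_basis:
  assumes mesh: "admissible_mesh L h" and L: "L > 0"
    and a: "\<And>i. a (i + num_cells L h) = a i"
    and gper: "\<And>x. g (x + L) = g x"
    and g: "\<And>x. (g has_real_derivative g' x) (at x)" and g': "continuous_on UNIV g'"
  shows "(LINT x:{0..L}|lborel. bdiff h (deriv (\<lambda>y. pw_linear h a y * g y)) x * nodal_basis L h (i + 1) x)
    = integral {0..1} (\<lambda>y. (cell_product h a g (i + 1) y - 2 * cell_product h a g i y
        + cell_product h a g (i - 1) y) / h)"
proof -
  define N where "N = num_cells L h"
  have h: "h > 0" and LN: "L = of_int N * h" and N1: "N \<ge> 1"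
    using mesh_cells[OF mesh] L by (auto simp: N_def)
  note aN = a[folded N_def]
  define \<psi> where "\<psi> = cell_product h a g"
  define D where "D k y = (a (k + 1) - a k) * g ((of_int k + y) * h)
      + ((1 - y) * a k + y * a (k + 1)) * (g' ((of_int k + y) * h) * h)" for k :: int and y
  define e :: "int \<Rightarrow> real" where "e k = (if N dvd k - (i + 1) then 1 else 0)" for k
  have contg: "continuous_on UNIV g"
    using g by (meson DERIV_isCont continuous_at_imp_continuous_on)
  have c\<psi>: "continuous_on {0..1} (\<psi> k)" for k
    unfolding \<psi>_def cell_product_def by (intro continuous_intros continuous_on_compose2[OF contg]) auto
  have cD: "continuous_on {0..1} (D k)" for k
    unfolding D_def
    by (intro continuous_intros continuous_on_compose2[OF contg] continuous_on_compose2[OF g']) auto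
  have d: "(\<psi> k has_real_derivative D k y) (at y)" for k y
  proof -
    have *: "((\<lambda>y. g ((of_int k + y) * h)) has_real_derivative g' ((of_int k + y) * h) * h) (at y)"
      by (rule DERIV_chain2[where f = g, OF g]) (auto intro!: derivative_eq_intros)
    have "((\<lambda>y. (1 - y) * a k + y * a (k + 1)) has_real_derivative a (k + 1) - a k) (at y)"
      by (auto intro!: derivative_eq_intros)
    from DERIV_mult'[OF this *] show ?thesis
      unfolding \<psi>_def cell_product_def D_def by (simp only: add.commute)
  qed
  have int\<psi>: "(\<psi> k has_integral integral {0..1} (\<psi> k)) {0..1}" for k
    by (rule integrable_integral[OF integrable_continuous_real[OF c\<psi>]])
  define J where "J k = integral {0..1} (\<psi> k)" for k
  have nodes: "\<psi> k 1 = \<psi> (k + 1) 0" for k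
    by (simp add: \<psi>_def cell_product_def add.commute)
  \<comment> \<open>Integration by parts on one cell; the boundary term survives only at the end where the weight is 1.\<close>
  have left: "((\<lambda>y. (1 - y) * D k y) has_integral (J k - \<psi> k 0)) {0..1}" for k
  proof -
    have "((\<lambda>y. - \<psi> k y + (1 - y) * D k y) has_integral ((1 - 1) * \<psi> k 1 - (1 - 0) * \<psi> k 0)) {0..1}"
    proof (rule fundamental_theorem_of_calculus)
      fix y :: real
      have "((\<lambda>y. 1 - y) has_real_derivative - 1) (at y within {0..1})"
        by (auto intro!: derivative_eq_intros)
      from DERIV_mult'[OF this has_field_derivative_at_within[OF d]]
      show "((\<lambda>y. (1 - y) * \<psi> k y) has_vector_derivative - \<psi> k y + (1 - y) * D k y) (at y within {0..1})"
        by (simp add: has_real_derivative_iff_has_vector_derivative[symmetric] algebra_simps)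
    qed simp
    from has_integral_add[OF this int\<psi>[of k]] show ?thesis by (simp add: J_def)
  qed
  have right: "((\<lambda>y. y * D k y) has_integral (\<psi> k 1 - J k)) {0..1}" for k
  proof -
    have "((\<lambda>y. \<psi> k y + y * D k y) has_integral (1 * \<psi> k 1 - 0 * \<psi> k 0)) {0..1}"
    proof (rule fundamental_theorem_of_calculus)
      fix y :: real
      from DERIV_mult'[OF DERIV_ident has_field_derivative_at_within[OF d]]
      show "((\<lambda>y. y * \<psi> k y) has_vector_derivative \<psi> k y + y * D k y) (at y within {0..1})"
        by (simp add: has_real_derivative_iff_has_vector_derivative[symmetric] algebra_simps)
    qed simp
    from has_integral_diff[OF this int\<psi>[of k]] show ?thesis by (simp add: J_def)
  qed
  define \<phi> where "\<phi> k y = (e k * ((1 - y) * D k y - (1 - y) * D (k - 1) y)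
      + e (k + 1) * (y * D k y - y * D (k - 1) y)) / h\<^sup>2" for k y
  have int\<phi>: "integral {0..1} (\<phi> k) = (e k * ((J k - \<psi> k 0) - (J (k - 1) - \<psi> (k - 1) 0))
      + e (k + 1) * ((\<psi> k 1 - J k) - (\<psi> (k - 1) 1 - J (k - 1)))) / h\<^sup>2" for k
    unfolding \<phi>_def
    by (intro integral_unique has_integral_divide has_integral_add has_integral_mult_right
        has_integral_diff left right)
  have \<psi>per: "\<psi> (k + N) = \<psi> k" for k
  proof
    fix y
    have "a (k + N + 1) = a (k + 1)" using aN[of "k + 1"] by (simp add: algebra_simps)
    moreover have "g ((of_int (k + N) + y) * h) = g ((of_int k + y) * h)"
      using gper[of "(of_int k + y) * h"] by (simp add: LN algebra_simps)
    ultimately show "\<psi> (k + N) y = \<psi> k y" by (simp add: \<psi>_def cell_product_def aN)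
  qed
  have per: "\<psi> (k + N) = \<psi> k" "J (k + N) = J k" "\<psi> (k + N - 1) = \<psi> (k - 1)"
    "J (k + N - 1) = J (k - 1)" "\<psi> (k + N - 2) = \<psi> (k - 2)" "J (k + N - 2) = J (k - 2)" for k
    using \<psi>per[of k] \<psi>per[of "k - 1"] \<psi>per[of "k - 2"] by (simp_all add: J_def algebra_simps)
  have eper: "e (k + N) = e k" "e (k + N - 1) = e (k - 1)" for k
    using dvd_add_triv_right_iff[of N "k - (i + 1)"] dvd_add_triv_right_iff[of N "k - 1 - (i + 1)"]
    by (simp_all add: e_def algebra_simps)
  have der: "deriv (\<lambda>y. pw_linear h a y * g y) x = D k (x / h - of_int k) / h"
    if "of_int k * h < x" "x < (of_int k + 1) * h" for k x
  proof -
    have "(of_int k + (x / h - of_int k)) * h = x" using h by simp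
    then show ?thesis
      using h by (simp add: deriv_inside_cell[OF h that g] D_def add_divide_distrib)
  qed
  have distribute: "(A / h - B / h) / h * ((1 - s) * p + s * q)
      = (p * ((1 - s) * A - (1 - s) * B) + q * (s * A - s * B)) / h\<^sup>2" for A B p q s
    by (simp add: power2_eq_square diff_divide_distrib[symmetric]) (simp add: algebra_simps)
  have "(LINT x:{0..L}|lborel. bdiff h (deriv (\<lambda>y. pw_linear h a y * g y)) x * nodal_basis L h (i + 1) x)
      = h * (\<Sum>k=1..N. integral {0..1} (\<phi> (k - 1)))"
    unfolding N_def
  proof (rule integral_over_period[OF mesh L])
    show "continuous_on {0..1} (\<phi> k)" for k
      unfolding \<phi>_def using h by (intro continuous_intros cD) auto
  next
    fix k :: int and x assume x: "of_int k * h < x" "x < (of_int k + 1) * h"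
    have 1: "deriv (\<lambda>y. pw_linear h a y * g y) (x - h) = D (k - 1) (x / h - of_int k) / h"
      using der[of "k - 1" "x - h"] x h by (simp add: diff_divide_distrib algebra_simps)
    have 2: "nodal_basis L h (i + 1) x = (1 - (x / h - of_int k)) * e k + (x / h - of_int k) * e (k + 1)"
      unfolding nodal_basis_def pw_linear_inside_cell[OF h x] e_def N_def by simp
    show "bdiff h (deriv (\<lambda>y. pw_linear h a y * g y)) x * nodal_basis L h (i + 1) x = \<phi> k (x / h - of_int k)"
      unfolding bdiff_def 1 2 der[OF x] \<phi>_def by (rule distribute)
  qed
  also have "\<dots> = (\<Sum>k=1..N. e (k - 1) * ((J (k - 1) - \<psi> (k - 1) 0) - (J (k - 1 - 1) - \<psi> (k - 1 - 1) 0)) / h)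
      + (\<Sum>k=1..N. e k * ((\<psi> (k - 1) 1 - J (k - 1)) - (\<psi> (k - 1 - 1) 1 - J (k - 1 - 1))) / h)"
    unfolding int\<phi> sum_distrib_left sum.distrib[symmetric]
    using h by (intro sum.cong) (auto simp: power2_eq_square distrib_left add_divide_distrib)
  also have "(\<Sum>k=1..N. e (k - 1) * ((J (k - 1) - \<psi> (k - 1) 0) - (J (k - 1 - 1) - \<psi> (k - 1 - 1) 0)) / h)
      = (\<Sum>k=1..N. e k * ((J k - \<psi> k 0) - (J (k - 1) - \<psi> (k - 1) 0)) / h)"
    using sum_periodic_shift[of "\<lambda>k. e (k - 1) * ((J (k - 1) - \<psi> (k - 1) 0) - (J (k - 1 - 1) - \<psi> (k - 1 - 1) 0)) / h" N]
    by (simp add: per eper)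
  also have "\<dots> = ((J (i + 1) - \<psi> (i + 1) 0) - (J i - \<psi> i 0)) / h"
    using sum_periodic_delta[of "\<lambda>k. ((J k - \<psi> k 0) - (J (k - 1) - \<psi> (k - 1) 0)) / h" N "i + 1"] N1
    by (simp add: e_def per)
  also have "(\<Sum>k=1..N. e k * ((\<psi> (k - 1) 1 - J (k - 1)) - (\<psi> (k - 1 - 1) 1 - J (k - 1 - 1))) / h)
     = ((\<psi> i 1 - J i) - (\<psi> (i - 1) 1 - J (i - 1))) / h"
    using sum_periodic_delta[of "\<lambda>k. ((\<psi> (k - 1) 1 - J (k - 1)) - (\<psi> (k - 1 - 1) 1 - J (k - 1 - 1))) / h" N "i + 1"] N1
    by (simp add: e_def per)
  also have "((J (i + 1) - \<psi> (i + 1) 0) - (J i - \<psi> i 0)) / h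
      + ((\<psi> i 1 - J i) - (\<psi> (i - 1) 1 - J (i - 1))) / h = (J (i + 1) - 2 * J i + J (i - 1)) / h"
    using nodes[of i] nodes[of "i - 1"] h by (simp add: field_simps)
  also have "\<dots> = integral {0..1} (\<lambda>y. (\<psi> (i + 1) y - 2 * \<psi> i y + \<psi> (i - 1) y) / h)"
    unfolding J_def
    by (intro integral_unique[symmetric] has_integral_divide has_integral_add has_integral_mult_right
        has_integral_diff int\<psi>)
  finally show ?thesis unfolding \<psi>_def .
qed

section \<open>Differences and square sums of the noise modes\<close>

lemma one_minus_cos_le: "1 - cos (t::real) \<le> t\<^sup>2 / 2"
proof -
  have "(sin (t / 2))\<^sup>2 \<le> (t / 2)\<^sup>2"
    using abs_sin_x_le_abs_x[of "t/2"] by (metis abs_le_square_iff)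
  then show ?thesis using cos_double_sin[of "t/2"] by (simp add: power_divide)
qed

lemma noise_mode_has_derivative:
  "\<exists>g'. continuous_on UNIV g' \<and> (\<forall>x. (noise_mode L l has_real_derivative g' x) (at x))"
proof -
  define k where "k = 2 * pi * of_int l / L"
  consider "l > 0" | "l = 0" | "l < 0" by linarith
  then show ?thesis
  proof cases
    case 1
    have eq: "noise_mode L l = (\<lambda>x. sqrt (2 / L) * sin (k * x))"
      using 1 by (auto simp: noise_mode_def fun_eq_iff k_def)
    show ?thesis unfolding eq
      by (rule exI[of _ "\<lambda>x. sqrt (2 / L) * (cos (k * x) * k)"])
         (auto intro!: derivative_eq_intros continuous_intros)
  next
    case 2
    have eq: "noise_mode L l = (\<lambda>x. 1 / sqrt L)"
      using 2 by (auto simp: noise_mode_def fun_eq_iff)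
    show ?thesis unfolding eq by (rule exI[of _ "\<lambda>x. 0"]) (auto intro!: derivative_eq_intros)
  next
    case 3
    have eq: "noise_mode L l = (\<lambda>x. sqrt (2 / L) * cos (k * x))"
      using 3 by (auto simp: noise_mode_def fun_eq_iff k_def)
    show ?thesis unfolding eq
      by (rule exI[of _ "\<lambda>x. - (sqrt (2 / L) * (sin (k * x) * k))"])
         (auto intro!: derivative_eq_intros continuous_intros)
  qed
qed

lemma continuous_on_noise_mode: "continuous_on A (noise_mode L l)"
  using noise_mode_has_derivative[of L l]
  by (meson DERIV_isCont continuous_at_imp_continuous_on)

lemma noise_mode_periodic:
  assumes "L > 0" shows "noise_mode L l (x + L) = noise_mode L l x"
proof -
  have "2 * pi * of_int l * (x + L) / L = 2 * pi * of_int l * x / L + 2 * pi * of_int l"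
    using assms by (simp add: field_simps)
  moreover have "sin (t + 2 * pi * of_int l) = sin t" "cos (t + 2 * pi * of_int l) = cos t" for t
    using sin_int_2pin[of l] cos_int_2pin[of l] by (simp_all add: sin_add cos_add)
  ultimately show ?thesis by (simp add: noise_mode_def)
qed

lemma noise_mode_square_pair:
  assumes "L > 0" "l > 0"
  shows "(noise_mode L l x)\<^sup>2 + (noise_mode L (- l) x)\<^sup>2 = 2 / L"
proof -
  define t where "t = 2 * pi * of_int l * x / L"
  have "noise_mode L l x = sqrt (2 / L) * sin t" "noise_mode L (- l) x = sqrt (2 / L) * cos t"
    using assms by (simp_all add: noise_mode_def t_def)
  then have "(noise_mode L l x)\<^sup>2 + (noise_mode L (- l) x)\<^sup>2 = 2 / L * ((sin t)\<^sup>2 + (cos t)\<^sup>2)"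
    using assms by (simp add: power_mult_distrib distrib_left del: sin_cos_squared_add)
  then show ?thesis by simp
qed

lemma noise_mode_square_zero:
  assumes "L > 0" shows "(noise_mode L 0 x)\<^sup>2 = 1 / L"
  using assms by (simp add: noise_mode_def power_divide)

lemma trig_increment:
  fixes t d :: real
  shows "\<bar>sin (t + d) - sin t\<bar> \<le> \<bar>d\<bar>" "\<bar>cos (t + d) - cos t\<bar> \<le> \<bar>d\<bar>"
proof -
  have s: "\<bar>sin (d / 2)\<bar> \<le> \<bar>d\<bar> / 2" using abs_sin_x_le_abs_x[of "d/2"] by simp
  have "\<bar>sin (d / 2)\<bar> * \<bar>cos ((t + d + t) / 2)\<bar> \<le> \<bar>d\<bar> / 2 * 1"
    by (intro mult_mono s) auto
  then show "\<bar>sin (t + d) - sin t\<bar> \<le> \<bar>d\<bar>" by (simp add: sin_diff_sin abs_mult)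
  have "\<bar>sin ((t + d + t) / 2)\<bar> * \<bar>sin (d / 2)\<bar> \<le> 1 * (\<bar>d\<bar> / 2)"
    by (intro mult_mono s) auto
  moreover have "\<bar>cos (t + d) - cos t\<bar> = 2 * (\<bar>sin ((t + d + t) / 2)\<bar> * \<bar>sin (d / 2)\<bar>)"
    by (simp add: cos_diff_cos abs_mult)
  ultimately show "\<bar>cos (t + d) - cos t\<bar> \<le> \<bar>d\<bar>" by simp
qed

lemma trig_second_difference:
  fixes t d :: real
  shows "\<bar>sin (t + d) - 2 * sin t + sin (t - d)\<bar> \<le> d\<^sup>2" "\<bar>cos (t + d) - 2 * cos t + cos (t - d)\<bar> \<le> d\<^sup>2"
proof -
  have 1: "\<bar>c\<bar> * (2 * (1 - cos d)) \<le> 1 * d\<^sup>2" if "\<bar>c\<bar> \<le> 1" for c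
    using that one_minus_cos_le[of d] by (intro mult_mono) auto
  have "sin (t + d) - 2 * sin t + sin (t - d) = - (sin t * (2 * (1 - cos d)))"
    by (simp add: sin_add sin_diff algebra_simps)
  then show "\<bar>sin (t + d) - 2 * sin t + sin (t - d)\<bar> \<le> d\<^sup>2"
    using 1[of "sin t"] by (simp add: abs_mult)
  have "cos (t + d) - 2 * cos t + cos (t - d) = - (cos t * (2 * (1 - cos d)))"
    by (simp add: cos_add cos_diff algebra_simps)
  then show "\<bar>cos (t + d) - 2 * cos t + cos (t - d)\<bar> \<le> d\<^sup>2"
    using 1[of "cos t"] by (simp add: abs_mult)
qed

text \<open>
  One derivative of mode \<open>l\<close> costs \<open>2 \<pi> \<bar>l\<bar> / L\<close>. In the first bound \<open>l\<^sup>2\<close> is enlarged to \<open>l\<^sup>4\<close>, so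
  that both bounds sum up to the same moment of the weights.
\<close>

lemma noise_mode_differences:
  assumes L: "L > 0"
  shows "(noise_mode L l (x + h) - noise_mode L l x)\<^sup>2 \<le> 2 / L * (2 * pi / L)\<^sup>2 * h\<^sup>2 * of_int l ^ 4"
    and "(noise_mode L l (x + h) - 2 * noise_mode L l x + noise_mode L l (x - h))\<^sup>2
      \<le> 2 / L * (2 * pi / L) ^ 4 * h ^ 4 * of_int l ^ 4"
proof -
  define k where "k = 2 * pi / L * of_int l"
  have arg: "2 * pi * of_int l * (x + h) / L = k * x + k * h"
    "2 * pi * of_int l * (x - h) / L = k * x - k * h" "2 * pi * of_int l * x / L = k * x"
    by (simp_all add: k_def field_simps add_divide_distrib diff_divide_distrib)
  have l: "(of_int l :: real)\<^sup>2 \<le> of_int l ^ 4"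
  proof (cases "l = 0")
    case False
    then have "1 \<le> \<bar>of_int l :: real\<bar>" by linarith
    then have "\<bar>of_int l :: real\<bar> ^ 2 \<le> \<bar>of_int l\<bar> ^ 4" by (intro power_increasing) auto
    then show ?thesis by simp
  qed auto
  have s: "(sqrt (2 / L))\<^sup>2 = 2 / L" using L by simp
  have sq: "(sqrt (2 / L) * d)\<^sup>2 \<le> 2 / L * e\<^sup>2" if "\<bar>d\<bar> \<le> e" for d e
    using that L abs_le_square_iff[of d e] unfolding power_mult_distrib s
    by (intro mult_left_mono) auto
  have "(noise_mode L l (x + h) - noise_mode L l x)\<^sup>2 \<le> 2 / L * \<bar>k * h\<bar>\<^sup>2"
    using sq[OF trig_increment(1)[of "k*x" "k*h"]] sq[OF trig_increment(2)[of "k*x" "k*h"]] L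
    by (auto simp: noise_mode_def arg right_diff_distrib[symmetric])
  also have "\<dots> = 2 / L * (2 * pi / L)\<^sup>2 * h\<^sup>2 * (of_int l)\<^sup>2"
    by (simp add: k_def power_mult_distrib power_divide)
  also have "\<dots> \<le> 2 / L * (2 * pi / L)\<^sup>2 * h\<^sup>2 * of_int l ^ 4"
    using l L by (intro mult_left_mono) auto
  finally show "(noise_mode L l (x + h) - noise_mode L l x)\<^sup>2 \<le> 2 / L * (2 * pi / L)\<^sup>2 * h\<^sup>2 * of_int l ^ 4" .
  have f: "c * a - 2 * (c * b) + c * d = c * (a - 2 * b + d)" for a b c d :: real by algebra
  have "(noise_mode L l (x + h) - 2 * noise_mode L l x + noise_mode L l (x - h))\<^sup>2 \<le> 2 / L * ((k * h)\<^sup>2)\<^sup>2"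
    using sq[OF trig_second_difference(1)[of "k*x" "k*h"]] sq[OF trig_second_difference(2)[of "k*x" "k*h"]] L
    by (auto simp: noise_mode_def arg f)
  also have "\<dots> = 2 / L * (2 * pi / L) ^ 4 * h ^ 4 * of_int l ^ 4"
    by (simp add: k_def power_mult_distrib power_divide)
  finally show "(noise_mode L l (x + h) - 2 * noise_mode L l x + noise_mode L l (x - h))\<^sup>2
      \<le> 2 / L * (2 * pi / L) ^ 4 * h ^ 4 * of_int l ^ 4" .
qed

text \<open>
  For symmetric weights, the value of \<open>\<Sum>\<^sub>l \<lambda>\<^sub>l\<^sup>2 g\<^sub>l(x)\<^sup>2\<close> over all modes, which is the same at every \<open>x\<close>.
\<close>

definition noise_intensity :: "real \<Rightarrow> (int \<Rightarrow> real) \<Rightarrow> real" where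
  "noise_intensity L lam = (lam 0)\<^sup>2 / L + (\<Sum>\<^sub>\<infinity>l\<in>{1..}. 2 * (lam l)\<^sup>2 / L)"

text \<open>
  A finite set of modes is enlarged to a symmetric interval, where \<open>sin\<^sup>2\<close> and \<open>cos\<^sup>2\<close> are paired.
\<close>

lemma finite_noise_intensity_le:
  fixes lam :: "int \<Rightarrow> real"
  assumes L: "L > 0" and sym: "\<And>l. lam (- l) = lam l"
    and summ: "(\<lambda>l. of_int l ^ 4 * (lam l)\<^sup>2) summable_on UNIV" and F: "finite F"
  shows "(\<Sum>l\<in>F. (lam l)\<^sup>2 * (noise_mode L l x)\<^sup>2) \<le> noise_intensity L lam"
proof -
  have "(\<lambda>l. (lam l)\<^sup>2) summable_on {1..}"
  proof (rule summable_on_comparison_test)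
    show "(\<lambda>l. of_int l ^ 4 * (lam l)\<^sup>2) summable_on {1..}"
      using summ by (rule summable_on_subset_banach) auto
    fix l :: int assume "l \<in> {1..}"
    then have "1 * (lam l)\<^sup>2 \<le> of_int l ^ 4 * (lam l)\<^sup>2"
      by (intro mult_right_mono one_le_power) auto
    then show "(lam l)\<^sup>2 \<le> of_int l ^ 4 * (lam l)\<^sup>2" by simp
  qed auto
  from summable_on_cmult_right[OF this, of "2 / L"]
  have sm: "(\<lambda>l. 2 * (lam l)\<^sup>2 / L) summable_on {1..}" by (simp add: field_simps)
  obtain K where K: "\<And>l. l \<in> F \<Longrightarrow> \<bar>l\<bar> \<le> K" "K \<ge> 0"
  proof -
    have "finite (insert 0 (abs ` F))" using F by simp
    then show ?thesis by (intro that[of "Max (insert 0 (abs ` F))"]) auto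
  qed
  let ?t = "\<lambda>l. (lam l)\<^sup>2 * (noise_mode L l x)\<^sup>2"
  have "(\<Sum>l\<in>F. ?t l) \<le> (\<Sum>l\<in>{-K..K}. ?t l)"
    using K(1) by (intro sum_mono2) (force simp: abs_le_iff)+
  also have "{-K..K} = insert 0 ({1..K} \<union> uminus ` {1..K})"
  proof -
    have "l \<in> uminus ` {1..K}" if "l < 0" "-K \<le> l" for l
      using that by (intro image_eqI[of _ _ "-l"]) auto
    then have "l \<in> insert 0 ({1..K} \<union> uminus ` {1..K})" if "l \<in> {-K..K}" for l
      using that by (cases "l < 0"; cases "l = 0") auto
    then show ?thesis using K(2) by auto
  qed
  also have "(\<Sum>l\<in>insert 0 ({1..K} \<union> uminus ` {1..K}). ?t l)
      = ?t 0 + ((\<Sum>l\<in>{1..K}. ?t l) + (\<Sum>l\<in>uminus ` {1..K}. ?t l))"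
    by (subst sum.insert, simp, force, subst sum.union_disjoint) auto
  also have "(\<Sum>l\<in>uminus ` {1..K}. ?t l) = (\<Sum>l\<in>{1..K}. (lam l)\<^sup>2 * (noise_mode L (- l) x)\<^sup>2)"
    by (subst sum.reindex) (auto simp: sym)
  also have "(\<Sum>l\<in>{1..K}. ?t l) + (\<Sum>l\<in>{1..K}. (lam l)\<^sup>2 * (noise_mode L (- l) x)\<^sup>2)
      = (\<Sum>l\<in>{1..K}. 2 * (lam l)\<^sup>2 / L)"
    unfolding sum.distrib[symmetric] distrib_left[symmetric]
    by (intro sum.cong) (auto simp: noise_mode_square_pair[OF L])
  also have "\<dots> \<le> (\<Sum>\<^sub>\<infinity>l\<in>{1..}. 2 * (lam l)\<^sup>2 / L)"
    using sm L by (intro finite_sum_le_infsum) auto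
  finally show ?thesis by (simp add: noise_intensity_def noise_mode_square_zero[OF L])
qed

lemma finite_noise_moment_le:
  fixes lam :: "int \<Rightarrow> real"
  assumes "(\<lambda>l. of_int l ^ 4 * (lam l)\<^sup>2) summable_on UNIV" "finite F"
  shows "(\<Sum>l\<in>F. of_int l ^ 4 * (lam l)\<^sup>2) \<le> (\<Sum>\<^sub>\<infinity>l. of_int l ^ 4 * (lam l)\<^sup>2)"
  using assms by (intro finite_sum_le_infsum) auto

section \<open>Elementary inequalities for squares and powers\<close>

lemma square_sum_young:
  fixes x y d :: real
  assumes "d > 0"
  shows "(x + y)\<^sup>2 \<le> (1 + d) * x\<^sup>2 + (1 + 1 / d) * y\<^sup>2"
proof -
  have "0 \<le> (sqrt d * x - y / sqrt d)\<^sup>2" by simp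
  also have "\<dots> = d * x\<^sup>2 - 2 * x * y + y\<^sup>2 / d"
    using assms by (simp add: power2_diff power_mult_distrib power_divide)
  finally show ?thesis by (simp add: power2_sum algebra_simps)
qed

lemma square_sum3: "(x + y + z)\<^sup>2 \<le> 3 * (x\<^sup>2 + y\<^sup>2 + z\<^sup>2)" for x y z :: real
  using sum_squares_ge_zero[of "x - y" "y - z"] zero_le_power2[of "x - z"]
  by (simp add: power2_eq_square algebra_simps)

lemma square_convex:
  fixes s a b :: real
  assumes "0 \<le> s" "s \<le> 1"
  shows "((1 - s) * a + s * b)\<^sup>2 \<le> (1 - s) * a\<^sup>2 + s * b\<^sup>2"
proof -
  have "0 \<le> s * (1 - s) * (a - b)\<^sup>2" using assms by simp
  then show ?thesis by (simp add: power2_eq_square algebra_simps)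
qed

text \<open>
  The second derivative of \<open>x powr q\<close> is decreasing for \<open>q < 2\<close>, so at the intermediate point, which
  is at least \<open>u / C\<close>, it is bounded by its value at \<open>u / C\<close>.
\<close>

lemma powr_taylor2:
  fixes u v q C :: real
  assumes q: "1 < q" "q < 2" and u: "u > 0" and C: "C \<ge> 1" and v: "u \<le> C * v"
  shows "\<exists>r. 0 \<le> r \<and> r \<le> q * (q - 1) / 2 * (C powr (2 - q) * u powr (q - 2)) * (v - u)\<^sup>2
    \<and> v powr q = u powr q + q * u powr (q - 1) * (v - u) + r"
proof (cases "u = v")
  case True
  then show ?thesis by (intro exI[of _ 0]) auto
next
  case False
  have vpos: "v > 0" using v u C by (metis less_le_trans zero_less_mult_pos zero_less_one)
  define D :: "nat \<Rightarrow> real \<Rightarrow> real" where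
    "D m = (if m = 0 then \<lambda>x. x powr q else if m = 1 then \<lambda>x. q * x powr (q - 1)
       else (\<lambda>x. q * (q - 1) * x powr (q - 2)))" for m
  have d: "\<forall>m t. m < 2 \<and> min u v \<le> t \<and> t \<le> max u v \<longrightarrow> (D m has_real_derivative D (Suc m) t) (at t)"
  proof (intro allI impI)
    fix m :: nat and t assume a: "m < 2 \<and> min u v \<le> t \<and> t \<le> max u v"
    then have t: "t > 0" using u vpos by auto
    from a consider "m = 0" | "m = 1" by linarith
    then show "(D m has_real_derivative D (Suc m) t) (at t)"
    proof cases
      case 1
      then show ?thesis using t by (auto simp: D_def intro!: derivative_eq_intros)
    next
      case 2
      then show ?thesis using t by (auto simp: D_def intro!: derivative_eq_intros)
    qed
  qed
  obtain t where t: "if v < u then v < t \<and> t < u else u < t \<and> t < v"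
    and e: "v powr q = (\<Sum>m<2. D m u / fact m * (v - u) ^ m) + D 2 t / fact 2 * (v - u) ^ 2"
    using Taylor[of 2 D "\<lambda>x. x powr q" "min u v" "max u v" u v] d False by (auto simp: D_def)
  have tpos: "t > 0" using t u vpos by (auto split: if_splits)
  have "u \<le> C * t"
  proof (cases "v < u")
    case True
    then have "C * v \<le> C * t" using t C by (intro mult_left_mono) auto
    with v show ?thesis by simp
  next
    case False
    then have "1 * u \<le> C * t" using t C u by (intro mult_mono) auto
    then show ?thesis by simp
  qed
  then have "u / C \<le> t" using C by (simp add: field_simps)
  then have "t powr (q - 2) \<le> (u / C) powr (q - 2)"
    using u C q by (intro powr_mono2') auto
  also have "\<dots> = C powr (2 - q) * u powr (q - 2)"
  proof -
    have "(u / C) powr (q - 2) = u powr (q - 2) / C powr (q - 2)"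
      using u C by (simp add: powr_divide)
    also have "C powr (q - 2) = inverse (C powr (2 - q))"
      using powr_minus[of C "2 - q"] by simp
    finally show ?thesis by (simp add: divide_inverse mult.commute)
  qed
  finally have le: "t powr (q - 2) \<le> C powr (2 - q) * u powr (q - 2)" .
  show ?thesis
  proof (intro exI conjI)
    show "0 \<le> q * (q - 1) / 2 * t powr (q - 2) * (v - u)\<^sup>2" using q by simp
    show "q * (q - 1) / 2 * t powr (q - 2) * (v - u)\<^sup>2
        \<le> q * (q - 1) / 2 * (C powr (2 - q) * u powr (q - 2)) * (v - u)\<^sup>2"
      using q le by (intro mult_right_mono mult_left_mono) auto
    show "v powr q = u powr q + q * u powr (q - 1) * (v - u) + q * (q - 1) / 2 * t powr (q - 2) * (v - u)\<^sup>2"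
      using e by (simp add: D_def numeral_2_eq_2)
  qed
qed

text \<open>
  Adding the Taylor expansions to both sides of \<open>u\<close>, the first-order parts combine to the second
  difference of \<open>u\<close> and the remainders are quadratic in the two slopes.
\<close>

lemma powr_second_difference:
  fixes u v w n C h \<epsilon> :: real
  assumes n: "2 < n" "n < 3" and u: "u > 0" and C: "C \<ge> 1"
    and v: "u \<le> C * v" and w: "u \<le> C * w" and h: "h > 0" and e: "\<epsilon> > 0"
  shows "((v powr (n/2) - 2 * u powr (n/2) + w powr (n/2)) / h\<^sup>2)\<^sup>2
    \<le> n\<^sup>2 / 4 * ((1 + \<epsilon> * ((n - 2) / 2)) * C powr (n - 2) * (u powr (n - 2) * ((v - 2 * u + w) / h\<^sup>2)\<^sup>2)
      + ((n - 2)\<^sup>2 / 4 + (n - 2) / (2 * \<epsilon>)) * C powr (4 - n)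
        * (u powr (n - 4) * (((v - u) / h)\<^sup>2 + ((u - w) / h)\<^sup>2)\<^sup>2))"
proof -
  define A B where "A = ((v - u) / h)\<^sup>2" and "B = ((u - w) / h)\<^sup>2"
  define K where "K = C powr (2 - n/2) * u powr (n/2 - 2)"
  obtain r where r: "0 \<le> r" "r \<le> n/2 * (n/2 - 1) / 2 * K * (v - u)\<^sup>2"
    "v powr (n/2) = u powr (n/2) + n/2 * u powr (n/2 - 1) * (v - u) + r"
    using powr_taylor2[of "n/2" u C v] n u C v unfolding K_def by auto
  obtain s where s: "0 \<le> s" "s \<le> n/2 * (n/2 - 1) / 2 * K * (w - u)\<^sup>2"
    "w powr (n/2) = u powr (n/2) + n/2 * u powr (n/2 - 1) * (w - u) + s"
    using powr_taylor2[of "n/2" u C w] n u C w unfolding K_def by auto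
  define P where "P = u powr (n/2 - 1) * ((v - 2 * u + w) / h\<^sup>2)"
  define R where "R = 2 / n * ((r + s) / h\<^sup>2)"
  define X where "X = C powr (4 - n) * (u powr (n - 4) * (A + B)\<^sup>2)"
  have X: "X \<ge> 0" by (simp add: X_def)
  have eq: "(v powr (n/2) - 2 * u powr (n/2) + w powr (n/2)) / h\<^sup>2 = n/2 * (P + R)"
    unfolding r(3) s(3) P_def R_def using n h by (simp add: field_simps)
  have R0: "0 \<le> R" unfolding R_def using r s n by simp
  have "(r + s) / h\<^sup>2 \<le> (n/2 * (n/2 - 1) / 2 * K * (v - u)\<^sup>2 + n/2 * (n/2 - 1) / 2 * K * (w - u)\<^sup>2) / h\<^sup>2"
    using r s by (intro divide_right_mono add_mono) auto
  also have "\<dots> = n/2 * ((n - 2) / 4 * K * (A + B))"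
    by (simp add: A_def B_def power_divide power2_commute[of w u] distrib_left[symmetric] add_divide_distrib[symmetric] del: distrib_left_numeral)
      (simp add: algebra_simps diff_divide_distrib add_divide_distrib)
  finally have "R \<le> 2 / n * (n/2 * ((n - 2) / 4 * K * (A + B)))"
    unfolding R_def using n by (intro mult_left_mono) auto
  also have "\<dots> = (n - 2) / 4 * K * (A + B)" using n by simp
  finally have "R \<le> (n - 2) / 4 * K * (A + B)" .
  then have "R\<^sup>2 \<le> ((n - 2) / 4 * K * (A + B))\<^sup>2" using R0 by (intro power_mono)
  also have "\<dots> = (n - 2)\<^sup>2 / 16 * (K\<^sup>2 * (A + B)\<^sup>2)" by (simp add: power_mult_distrib power_divide)
  also have "K\<^sup>2 = C powr (4 - n) * u powr (n - 4)"
    unfolding K_def power_mult_distrib using u C by (simp add: powr_power)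
  finally have R2: "R\<^sup>2 \<le> (n - 2)\<^sup>2 / 16 * X" by (simp add: X_def mult.assoc)
  have P2: "P\<^sup>2 = u powr (n - 2) * ((v - 2 * u + w) / h\<^sup>2)\<^sup>2"
    unfolding P_def power_mult_distrib using u by (simp add: powr_power)
  \<comment> \<open>The parameter in Young's inequality for which the factor of the first square is the one required.\<close>
  define d where "d = \<epsilon> * ((n - 2) / 2)"
  have d: "d > 0" using e n by (simp add: d_def)
  have "(P + R)\<^sup>2 \<le> (1 + d) * P\<^sup>2 + (1 + 1 / d) * R\<^sup>2" by (rule square_sum_young[OF d])
  also have "\<dots> \<le> (1 + d) * C powr (n - 2) * P\<^sup>2 + (1 + 1 / d) * ((n - 2)\<^sup>2 / 16 * X)"
  proof -
    \<comment> \<open>The Taylor expansion at the centre leaves the factor 1 here, which is enlarged.\<close>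
    have "1 \<le> C powr (n - 2)" using C n by (simp add: ge_one_powr_ge_zero)
    then have "(1 + d) * 1 * P\<^sup>2 \<le> (1 + d) * C powr (n - 2) * P\<^sup>2"
      using d by (intro mult_right_mono mult_left_mono) auto
    then show ?thesis using R2 d by (intro add_mono mult_left_mono) auto
  qed
  also have "(1 + 1 / d) * ((n - 2)\<^sup>2 / 16 * X) = ((n - 2)\<^sup>2 / 16 + (n - 2) / (8 * \<epsilon>)) * X"
    unfolding d_def using n e by (simp add: field_simps power2_eq_square)
  also have "\<dots> \<le> ((n - 2)\<^sup>2 / 4 + (n - 2) / (2 * \<epsilon>)) * X"
    using X n e by (intro mult_right_mono add_mono divide_left_mono) auto
  finally have fin: "(P + R)\<^sup>2 \<le> (1 + d) * C powr (n - 2) * P\<^sup>2 + ((n - 2)\<^sup>2 / 4 + (n - 2) / (2 * \<epsilon>)) * X"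
    by simp
  have "((v powr (n/2) - 2 * u powr (n/2) + w powr (n/2)) / h\<^sup>2)\<^sup>2 = n\<^sup>2 / 4 * (P + R)\<^sup>2"
    unfolding eq by (simp add: power_mult_distrib power_divide)
  also have "\<dots> \<le> n\<^sup>2 / 4 * ((1 + d) * C powr (n - 2) * P\<^sup>2 + ((n - 2)\<^sup>2 / 4 + (n - 2) / (2 * \<epsilon>)) * X)"
    using fin by (intro mult_left_mono) auto
  finally show ?thesis unfolding P2 X_def d_def A_def B_def by (simp only: mult.assoc)
qed

lemma powr_difference:
  fixes u v q C :: real
  assumes q: "1 < q" and u: "u > 0" and v: "v > 0" and C: "C \<ge> 1" "v \<le> C * u"
  shows "(v powr q - u powr q)\<^sup>2 \<le> q\<^sup>2 * C powr (2 * q - 2) * u powr (2 * q - 2) * (v - u)\<^sup>2"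
proof (cases "u = v")
  case False
  have d: "((\<lambda>x. x powr q) has_real_derivative q * x powr (q - 1)) (at x)" if "x > 0" for x :: real
    using that by (auto intro!: derivative_eq_intros)
  obtain z where z: "min u v < z" "z < max u v" and e: "\<bar>v powr q - u powr q\<bar> = \<bar>v - u\<bar> * (q * z powr (q - 1))"
  proof (cases "u < v")
    case True
    from MVT2[OF this, of "\<lambda>x. x powr q" "\<lambda>x. q * x powr (q - 1)"] d u obtain z where
      "u < z" "z < v" "v powr q - u powr q = (v - u) * (q * z powr (q - 1))" by force
    then show ?thesis using True q by (intro that[of z]) (auto simp: abs_mult)
  next
    case f: False
    with False have "v < u" by simp
    from MVT2[OF this, of "\<lambda>x. x powr q" "\<lambda>x. q * x powr (q - 1)"] d v obtain z where
      "v < z" "z < u" "u powr q - v powr q = (u - v) * (q * z powr (q - 1))" by force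
    then show ?thesis using f q
      by (intro that[of z]) (auto simp: abs_mult abs_minus_commute[of "v powr q"] abs_minus_commute[of v])
  qed
  have "u \<le> C * u" using C u by (simp add: mult_le_cancel_right1)
  with z C have zC: "z \<le> C * u" by auto
  have z0: "z > 0" using z u v by auto
  have "(v powr q - u powr q)\<^sup>2 = (\<bar>v - u\<bar> * (q * z powr (q - 1)))\<^sup>2" unfolding e[symmetric] by simp
  also have "\<dots> \<le> (\<bar>v - u\<bar> * (q * (C * u) powr (q - 1)))\<^sup>2"
    using z0 zC q by (intro power_mono mult_left_mono powr_mono2) auto
  also have "\<dots> = q\<^sup>2 * C powr (2 * q - 2) * u powr (2 * q - 2) * (v - u)\<^sup>2"
    using u C by (simp add: power_mult_distrib powr_mult powr_power algebra_simps)
  finally show ?thesis .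
qed (use assms in simp)

text \<open>
  Jensen's inequality for the square: the variance of \<open>f\<close> on the unit interval is nonnegative.
\<close>

lemma square_integral_unit_le:
  fixes f :: "real \<Rightarrow> real"
  assumes "continuous_on {0..1} f"
  shows "(integral {0..1} f)\<^sup>2 \<le> integral {0..1} (\<lambda>y. (f y)\<^sup>2)"
proof -
  define c where "c = integral {0..1} f"
  have f: "(f has_integral c) {0..1}" unfolding c_def
    using assms by (intro integrable_integral integrable_continuous_real)
  have f2: "((\<lambda>y. (f y)\<^sup>2) has_integral integral {0..1} (\<lambda>y. (f y)\<^sup>2)) {0..1}"
    using assms by (intro integrable_integral integrable_continuous_real continuous_intros)
  have "((\<lambda>y. c\<^sup>2) has_integral c\<^sup>2) {0..1::real}" using has_integral_const_real[of "c\<^sup>2" 0 1] by simp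
  from has_integral_add[OF has_integral_diff[OF f2 has_integral_mult_right[OF f, of "2 * c"]] this]
  have "((\<lambda>y. (f y - c)\<^sup>2) has_integral (integral {0..1} (\<lambda>y. (f y)\<^sup>2) - 2 * c * c + c\<^sup>2)) {0..1}"
    by (simp add: power2_diff algebra_simps)
  then have "0 \<le> integral {0..1} (\<lambda>y. (f y)\<^sup>2) - 2 * c * c + c\<^sup>2"
    by (rule has_integral_nonneg) auto
  then show ?thesis by (simp add: c_def power2_eq_square)
qed

section \<open>Summation over the modes\<close>

definition noise_moment :: "(int \<Rightarrow> real) \<Rightarrow> real" where
  "noise_moment lam = (\<Sum>\<^sub>\<infinity>l. of_int l ^ 4 * (lam l)\<^sup>2)"

text \<open>
  The second difference quotient with step \<open>h\<close> of the product of a nodal sequence, centred at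
  node \<open>j\<close>, with a function, centred at the point \<open>x\<close>; inside a cell, \<open>x\<close> lies off the node.
\<close>

definition weighted_second_difference :: "real \<Rightarrow> (int \<Rightarrow> real) \<Rightarrow> (real \<Rightarrow> real) \<Rightarrow> int \<Rightarrow> real \<Rightarrow> real" where
  "weighted_second_difference h a g j x = (a (j + 1) * g (x + h) - 2 * a j * g x + a (j - 1) * g (x - h)) / h\<^sup>2"

text \<open>
  Sorting the linear interpolation by nodes: the integrand of \<open>flux_against_basis\<close> is itself an
  interpolation between second differences centred at two neighbouring nodes.
\<close>

lemma cell_product_second_difference:
  assumes "h > 0"
  shows "(cell_product h a g (i + 1) y - 2 * cell_product h a g i y + cell_product h a g (i - 1) y) / h
    = h * ((1 - y) * weighted_second_difference h a g i ((of_int i + y) * h)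
        + y * weighted_second_difference h a g (i + 1) ((of_int i + y) * h))"
proof -
  have "(of_int (i + 1) + y) * h = (of_int i + y) * h + h" "(of_int (i - 1) + y) * h = (of_int i + y) * h - h"
    "i - 1 + 1 = i" "i + 1 - 1 = i"
    by (simp_all add: algebra_simps)
  then show ?thesis
    unfolding cell_product_def weighted_second_difference_def
    using assms by (simp add: field_simps power2_eq_square)
qed

text \<open>
  Discrete product rule. The first term is the part in which both differences fall on the sequence.
\<close>

lemma weighted_second_difference_square_le:
  fixes L h x \<eta> :: real and a :: "int \<Rightarrow> real"
  assumes L: "L > 0" and h: "h > 0" and \<eta>: "\<eta> > 0"
  shows "(weighted_second_difference h a (noise_mode L l) j x)\<^sup>2
    \<le> (1 + \<eta>) * (((a (j + 1) - 2 * a j + a (j - 1)) / h\<^sup>2)\<^sup>2 * (noise_mode L l x)\<^sup>2)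
      + 3 * (1 + 1 / \<eta>) * (2 / L * (2 * pi / L)\<^sup>2 * (((a (j + 1) - a j) / h)\<^sup>2 + ((a j - a (j - 1)) / h)\<^sup>2)
          + 2 / L * (2 * pi / L) ^ 4 * (a (j - 1))\<^sup>2) * of_int l ^ 4"
proof -
  let ?g = "noise_mode L l"
  define p where "p = (?g (x + h) - ?g x) / h"
  define q where "q = (?g (x + h) - 2 * ?g x + ?g (x - h)) / h\<^sup>2"
  define d e where "d = (a (j + 1) - a j) / h" and "e = (a j - a (j - 1)) / h"
  define D where "D = (a (j + 1) - 2 * a j + a (j - 1)) / h\<^sup>2"
  define G1 G2 where "G1 = 2 / L * (2 * pi / L)\<^sup>2" and "G2 = 2 / L * (2 * pi / L) ^ 4"
  define m :: real where "m = of_int l ^ 4"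
  have p: "p\<^sup>2 \<le> G1 * m"
    using noise_mode_differences(1)[OF L, of l x h] h by (simp add: p_def G1_def m_def power_divide field_simps)
  have "q\<^sup>2 = (?g (x + h) - 2 * ?g x + ?g (x - h))\<^sup>2 / h ^ 4"
    by (simp add: q_def power_divide power_mult[symmetric])
  also have "\<dots> \<le> G2 * m"
    using noise_mode_differences(2)[OF L, of l x h] h by (simp add: G2_def m_def field_simps)
  finally have q: "q\<^sup>2 \<le> G2 * m" .
  have split: "weighted_second_difference h a ?g j x = D * ?g x + (d * p + e * p + a (j - 1) * q)"
    unfolding weighted_second_difference_def D_def d_def e_def p_def q_def using h
    by (simp add: field_simps power2_eq_square)
  have "(d * p + e * p + a (j - 1) * q)\<^sup>2 \<le> 3 * (d\<^sup>2 * p\<^sup>2 + e\<^sup>2 * p\<^sup>2 + (a (j - 1))\<^sup>2 * q\<^sup>2)"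
    using square_sum3[of "d * p" "e * p" "a (j - 1) * q"] by (simp add: power_mult_distrib)
  also have "\<dots> \<le> 3 * (d\<^sup>2 * (G1 * m) + e\<^sup>2 * (G1 * m) + (a (j - 1))\<^sup>2 * (G2 * m))"
    using p q by (intro mult_left_mono add_mono) auto
  also have "\<dots> = 3 * (G1 * (d\<^sup>2 + e\<^sup>2) + G2 * (a (j - 1))\<^sup>2) * m" by (simp add: algebra_simps)
  finally have r: "(d * p + e * p + a (j - 1) * q)\<^sup>2 \<le> 3 * (G1 * (d\<^sup>2 + e\<^sup>2) + G2 * (a (j - 1))\<^sup>2) * m" .
  have "(D * ?g x + (d * p + e * p + a (j - 1) * q))\<^sup>2
      \<le> (1 + \<eta>) * (D * ?g x)\<^sup>2 + (1 + 1 / \<eta>) * (d * p + e * p + a (j - 1) * q)\<^sup>2"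
    by (rule square_sum_young[OF \<eta>])
  also have "\<dots> \<le> (1 + \<eta>) * (D * ?g x)\<^sup>2 + (1 + 1 / \<eta>) * (3 * (G1 * (d\<^sup>2 + e\<^sup>2) + G2 * (a (j - 1))\<^sup>2) * m)"
    using r \<eta> by (intro add_left_mono mult_left_mono) auto
  finally show ?thesis
    unfolding split power_mult_distrib unfolding D_def d_def e_def G1_def G2_def m_def
    by (simp only: mult.assoc mult.left_commute)
qed

text \<open>
  A bound for the weighted squares after summation over the modes. It is independent of the
  position inside the cell, so the integral over the cell becomes trivial.
\<close>

definition mode_sum_bound :: "real \<Rightarrow> (int \<Rightarrow> real) \<Rightarrow> real \<Rightarrow> real \<Rightarrow> (int \<Rightarrow> real) \<Rightarrow> int \<Rightarrow> real" where
  "mode_sum_bound L lam \<eta> h a j =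
     (1 + \<eta>) * (((a (j + 1) - 2 * a j + a (j - 1)) / h\<^sup>2)\<^sup>2 * noise_intensity L lam)
      + 3 * (1 + 1 / \<eta>) * (2 / L * (2 * pi / L)\<^sup>2 * (((a (j + 1) - a j) / h)\<^sup>2 + ((a j - a (j - 1)) / h)\<^sup>2)
          + 2 / L * (2 * pi / L) ^ 4 * (a (j - 1))\<^sup>2) * noise_moment lam"

lemma weighted_second_difference_mode_sum_le:
  assumes L: "L > 0" and h: "h > 0" and \<eta>: "\<eta> > 0" and sym: "\<And>l. lam (- l) = lam l"
    and summ: "(\<lambda>l. of_int l ^ 4 * (lam l)\<^sup>2) summable_on UNIV" and F: "finite F"
  shows "(\<Sum>l\<in>F. (lam l)\<^sup>2 * (weighted_second_difference h a (noise_mode L l) j x)\<^sup>2)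
    \<le> mode_sum_bound L lam \<eta> h a j"
proof -
  define A where "A = (1 + \<eta>) * ((a (j + 1) - 2 * a j + a (j - 1)) / h\<^sup>2)\<^sup>2"
  define B where "B = 3 * (1 + 1 / \<eta>) * (2 / L * (2 * pi / L)\<^sup>2 * (((a (j + 1) - a j) / h)\<^sup>2 + ((a j - a (j - 1)) / h)\<^sup>2)
          + 2 / L * (2 * pi / L) ^ 4 * (a (j - 1))\<^sup>2)"
  have AB: "A \<ge> 0" "B \<ge> 0" unfolding A_def B_def using \<eta> L by (auto intro!: mult_nonneg_nonneg add_nonneg_nonneg)
  have "(\<Sum>l\<in>F. (lam l)\<^sup>2 * (weighted_second_difference h a (noise_mode L l) j x)\<^sup>2)
      \<le> (\<Sum>l\<in>F. (lam l)\<^sup>2 * (A * (noise_mode L l x)\<^sup>2 + B * of_int l ^ 4))"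
    using weighted_second_difference_square_le[OF L h \<eta>, of a _ j x]
    by (intro sum_mono mult_left_mono) (auto simp: A_def B_def mult.assoc)
  also have "\<dots> = A * (\<Sum>l\<in>F. (lam l)\<^sup>2 * (noise_mode L l x)\<^sup>2) + B * (\<Sum>l\<in>F. of_int l ^ 4 * (lam l)\<^sup>2)"
    unfolding sum_distrib_left sum.distrib[symmetric] by (intro sum.cong) (auto simp: algebra_simps)
  also have "\<dots> \<le> A * noise_intensity L lam + B * noise_moment lam"
    unfolding noise_moment_def using AB
    by (intro add_mono mult_left_mono finite_noise_intensity_le[OF L sym summ F] finite_noise_moment_le[OF summ F])
  finally show ?thesis by (simp add: mode_sum_bound_def A_def B_def mult.assoc)
qed

text \<open>
  Jensen's inequality moves the square into the cell integral, and convexity of the square moves it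
  into the interpolation between the two nodes. Only then is the sum over the modes taken, at a fixed
  point, where \<open>finite_noise_intensity_le\<close> applies.
\<close>

lemma noise_flux_mode_sum_le:
  assumes mesh: "admissible_mesh L h" and L: "L > 0" and \<eta>: "\<eta> > 0" and sym: "\<And>l. lam (- l) = lam l"
    and summ: "(\<lambda>l. of_int l ^ 4 * (lam l)\<^sup>2) summable_on UNIV" and F: "finite F"
    and a: "\<And>i. a (i + num_cells L h) = a i"
  shows "(\<Sum>l\<in>F. (lam l)\<^sup>2 * (LINT x:{0..L}|lborel.
        bdiff h (deriv (\<lambda>y. pw_linear h a y * noise_mode L l y)) x * nodal_basis L h (i + 1) x)\<^sup>2)
    \<le> h\<^sup>2 * ((mode_sum_bound L lam \<eta> h a i + mode_sum_bound L lam \<eta> h a (i + 1)) / 2)"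
proof -
  note h = mesh_cells(1)[OF mesh]
  define s where "s l j y = weighted_second_difference h a (noise_mode L l) j ((of_int i + y) * h)" for l j y
  define Q where "Q l = (LINT x:{0..L}|lborel.
        bdiff h (deriv (\<lambda>y. pw_linear h a y * noise_mode L l y)) x * nodal_basis L h (i + 1) x)" for l
  define Z where "Z j = mode_sum_bound L lam \<eta> h a j" for j
  have cs: "continuous_on {0..1} (s l j)" for l j
    unfolding s_def weighted_second_difference_def
    by (intro continuous_intros continuous_on_compose2[OF continuous_on_noise_mode[of UNIV]]) (use h in auto)
  have Q: "(Q l)\<^sup>2 \<le> h\<^sup>2 * integral {0..1} (\<lambda>y. (1 - y) * (s l i y)\<^sup>2 + y * (s l (i + 1) y)\<^sup>2)" for l
  proof -
    obtain g' where g': "continuous_on UNIV g'" "\<And>x. (noise_mode L l has_real_derivative g' x) (at x)"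
      using noise_mode_has_derivative[of L l] by auto
    have "Q l = integral {0..1} (\<lambda>y. h * ((1 - y) * s l i y + y * s l (i + 1) y))"
      unfolding Q_def s_def cell_product_second_difference[OF h, symmetric]
      using a noise_mode_periodic[OF L] g' by (intro flux_against_basis[OF mesh L]) auto
    then have "(Q l)\<^sup>2 \<le> integral {0..1} (\<lambda>y. (h * ((1 - y) * s l i y + y * s l (i + 1) y))\<^sup>2)"
      by (simp only:) (intro square_integral_unit_le continuous_intros cs)
    also have "\<dots> \<le> integral {0..1} (\<lambda>y. h\<^sup>2 * ((1 - y) * (s l i y)\<^sup>2 + y * (s l (i + 1) y)\<^sup>2))"
      unfolding power_mult_distrib
      by (intro integral_le integrable_continuous_real continuous_intros cs mult_left_mono square_convex) auto
    finally show ?thesis by simp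
  qed
  have "(\<Sum>l\<in>F. (lam l)\<^sup>2 * (Q l)\<^sup>2)
      \<le> (\<Sum>l\<in>F. (lam l)\<^sup>2 * (h\<^sup>2 * integral {0..1} (\<lambda>y. (1 - y) * (s l i y)\<^sup>2 + y * (s l (i + 1) y)\<^sup>2)))"
    using Q by (intro sum_mono mult_left_mono) auto
  also have "\<dots> = h\<^sup>2 * (\<Sum>l\<in>F. integral {0..1} (\<lambda>y. (lam l)\<^sup>2 * ((1 - y) * (s l i y)\<^sup>2 + y * (s l (i + 1) y)\<^sup>2)))"
    unfolding sum_distrib_left by (intro sum.cong) auto
  also have "(\<Sum>l\<in>F. integral {0..1} (\<lambda>y. (lam l)\<^sup>2 * ((1 - y) * (s l i y)\<^sup>2 + y * (s l (i + 1) y)\<^sup>2)))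
      = integral {0..1} (\<lambda>y. \<Sum>l\<in>F. (lam l)\<^sup>2 * ((1 - y) * (s l i y)\<^sup>2 + y * (s l (i + 1) y)\<^sup>2))"
    by (intro integral_sum[symmetric] F integrable_continuous_real continuous_intros cs)
  also have "\<dots> \<le> integral {0..1} (\<lambda>y. (1 - y) * Z i + y * Z (i + 1))"
  proof (intro integral_le integrable_continuous_real continuous_intros cs)
    fix y :: real assume y: "y \<in> {0..1}"
    have "(\<Sum>l\<in>F. (lam l)\<^sup>2 * ((1 - y) * (s l i y)\<^sup>2 + y * (s l (i + 1) y)\<^sup>2))
        = (1 - y) * (\<Sum>l\<in>F. (lam l)\<^sup>2 * (s l i y)\<^sup>2) + y * (\<Sum>l\<in>F. (lam l)\<^sup>2 * (s l (i + 1) y)\<^sup>2)"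
      unfolding sum_distrib_left sum.distrib[symmetric] by (intro sum.cong) (auto simp: algebra_simps)
    also have "\<dots> \<le> (1 - y) * Z i + y * Z (i + 1)"
      unfolding s_def Z_def using y
      by (intro add_mono mult_left_mono weighted_second_difference_mode_sum_le[OF L h \<eta> sym summ F]) auto
    finally show "(\<Sum>l\<in>F. (lam l)\<^sup>2 * ((1 - y) * (s l i y)\<^sup>2 + y * (s l (i + 1) y)\<^sup>2))
        \<le> (1 - y) * Z i + y * Z (i + 1)" .
  qed
  also have "integral {0..1} (\<lambda>y. (1 - y) * Z i + y * Z (i + 1)) = (Z i + Z (i + 1)) / 2"
  proof (rule integral_unique)
    have "((\<lambda>y. (1 - y) * Z i + y * Z (i + 1)) has_integral
        ((1 - 1\<^sup>2/2) * Z i + 1\<^sup>2/2 * Z (i + 1)) - ((0 - 0\<^sup>2/2) * Z i + 0\<^sup>2/2 * Z (i + 1))) {0..1::real}"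
      by (rule fundamental_theorem_of_calculus)
         (auto intro!: derivative_eq_intros simp: has_real_derivative_iff_has_vector_derivative[symmetric])
    then show "((\<lambda>y. (1 - y) * Z i + y * Z (i + 1)) has_integral (Z i + Z (i + 1)) / 2) {0..1}"
      by (simp add: add_divide_distrib)
  qed
  finally show ?thesis by (simp add: Q_def Z_def mult_left_mono)
qed

lemma sum_mode_sum_bound:
  assumes a: "\<And>i. a (i + N) = a i"
  shows "(\<Sum>i=1..N. (mode_sum_bound L lam \<eta> h a i + mode_sum_bound L lam \<eta> h a (i + 1)) / 2)
    = (1 + \<eta>) * noise_intensity L lam * (\<Sum>i=1..N. ((a (i + 1) - 2 * a i + a (i - 1)) / h\<^sup>2)\<^sup>2)
      + 3 * (1 + 1 / \<eta>) * noise_moment lam * (2 / L * (2 * pi / L)\<^sup>2 * (2 * (\<Sum>i=1..N. ((a (i + 1) - a i) / h)\<^sup>2))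
          + 2 / L * (2 * pi / L) ^ 4 * (\<Sum>i=1..N. (a i)\<^sup>2))"
proof -
  have ap: "a (i + N + 1) = a (i + 1)" "a (i + N - 1) = a (i - 1)" for i
    using a[of "i + 1"] a[of "i - 1"] by (simp_all add: algebra_simps)
  have Z: "mode_sum_bound L lam \<eta> h a (i + N) = mode_sum_bound L lam \<eta> h a i" for i
    by (simp add: mode_sum_bound_def a ap)
  have s1: "(\<Sum>i=1..N. ((a i - a (i - 1)) / h)\<^sup>2) = (\<Sum>i=1..N. ((a (i + 1) - a i) / h)\<^sup>2)"
    using sum_periodic_shift[of "\<lambda>i. ((a i - a (i - 1)) / h)\<^sup>2" N] by (simp add: a ap)
  have s2: "(\<Sum>i=1..N. (a (i - 1))\<^sup>2) = (\<Sum>i=1..N. (a i)\<^sup>2)"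
    using sum_periodic_shift[of "\<lambda>i. (a (i - 1))\<^sup>2" N] by (simp add: ap)
  have "(\<Sum>i=1..N. (mode_sum_bound L lam \<eta> h a i + mode_sum_bound L lam \<eta> h a (i + 1)) / 2)
      = (\<Sum>i=1..N. mode_sum_bound L lam \<eta> h a i)"
    using sum_periodic_shift[of "mode_sum_bound L lam \<eta> h a" N, OF Z]
    by (simp add: sum_divide_distrib[symmetric] sum.distrib)
  also have "\<dots> = (1 + \<eta>) * noise_intensity L lam * (\<Sum>i=1..N. ((a (i + 1) - 2 * a i + a (i - 1)) / h\<^sup>2)\<^sup>2)
      + 3 * (1 + 1 / \<eta>) * noise_moment lam * (2 / L * (2 * pi / L)\<^sup>2 * ((\<Sum>i=1..N. ((a (i + 1) - a i) / h)\<^sup>2)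
          + (\<Sum>i=1..N. ((a i - a (i - 1)) / h)\<^sup>2))
          + 2 / L * (2 * pi / L) ^ 4 * (\<Sum>i=1..N. (a (i - 1))\<^sup>2))"
    unfolding mode_sum_bound_def sum.distrib[symmetric] sum_distrib_left
    by (intro sum.cong refl) (simp only: algebra_simps)
  finally show ?thesis unfolding s1 s2 by simp
qed

section \<open>The estimate at a fixed time\<close>

lemma periodic_nodal:
  assumes mesh: "admissible_mesh L h" and v: "v \<in> Xh L h"
  shows "nodal h v (i + num_cells L h) = nodal h v i"
proof -
  have "of_int (i + num_cells L h) * h = of_int i * h + L"
    using mesh_cells(2)[OF mesh] by (simp add: algebra_simps)
  then show ?thesis using v by (simp add: nodal_def Xh_def)
qed

lemma Xh_inside_cell:
  assumes h: "h > 0" and v: "v \<in> Xh L h" and x: "of_int k * h \<le> x" "x \<le> (of_int k + 1) * h"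
  shows "v x = (1 - (x / h - of_int k)) * nodal h v k + (x / h - of_int k) * nodal h v (k + 1)"
proof -
  obtain a b where ab: "\<forall>x\<in>{(of_int (k + 1) - 1) * h..of_int (k + 1) * h}. v x = a + b * x"
    using v unfolding Xh_def by blast
  have v: "v x = a + b * x" "nodal h v k = a + b * (of_int k * h)" "nodal h v (k + 1) = a + b * ((of_int k + 1) * h)"
    using ab x h by (auto simp: nodal_def)
  have "a + b * (y * h) = (1 - (y - k)) * (a + b * (k * h)) + (y - k) * (a + b * ((k + 1) * h))" for y k
    by (simp add: algebra_simps)
  from this[of "x / h" "of_int k"] show ?thesis unfolding v using h by simp
qed

lemma M2h_eq_pw_linear: "M2h n h v = pw_linear h (\<lambda>i. \<bar>nodal h v i\<bar> powr (n / 2))"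
  by (simp add: M2h_def nodal_interp_def nodal_def[abs_def])

definition noise_flux_square :: "real \<Rightarrow> real \<Rightarrow> real \<Rightarrow> int \<Rightarrow> (real \<Rightarrow> real) \<Rightarrow> real" where
  "noise_flux_square L n h l v = (\<Sum>i=1..num_cells L h. (LINT x:{0..L}|lborel.
     bdiff h (deriv (\<lambda>y. M2h n h v y * noise_mode L l y)) x * nodal_basis L h (i + 1) x)\<^sup>2)"

definition curvature_term :: "real \<Rightarrow> real \<Rightarrow> real \<Rightarrow> (real \<Rightarrow> real) \<Rightarrow> real" where
  "curvature_term L n h v = h * (\<Sum>i=1..num_cells L h. nodal h v i powr (n - 2)
     * \<bar>nodal h (discrete_laplacian h v) i\<bar>\<^sup>2)"

definition quartic_slope_term :: "real \<Rightarrow> real \<Rightarrow> real \<Rightarrow> (real \<Rightarrow> real) \<Rightarrow> real" where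
  "quartic_slope_term L n h v = h * (\<Sum>i=1..num_cells L h. nodal h v i powr (n - 4)
     * (\<bar>fquot h v i\<bar> ^ 4 + 2 * \<bar>fquot h v i\<bar>\<^sup>2 * \<bar>bquot h v i\<bar>\<^sup>2 + \<bar>bquot h v i\<bar> ^ 4))"

definition slope_term :: "real \<Rightarrow> real \<Rightarrow> real \<Rightarrow> (real \<Rightarrow> real) \<Rightarrow> real" where
  "slope_term L n h v = h * (\<Sum>i=1..num_cells L h. nodal h v i powr (n - 2) * \<bar>fquot h v i\<bar>\<^sup>2)"

definition power_term :: "real \<Rightarrow> real \<Rightarrow> (real \<Rightarrow> real) \<Rightarrow> real" where
  "power_term L n v = (LINT x:{0..L}|lborel. v x powr n)"

lemma continuous_on_affine_powr:
  fixes a b n :: real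
  assumes "a > 0" "b > 0"
  shows "continuous_on {0..1} (\<lambda>y. ((1 - y) * a + y * b) powr n)"
proof -
  have "(1 - y) * a + y * b \<noteq> 0" if "y \<in> {0..1}" for y
    using that assms convex_bound_lt[of "- a" 0 "- b" "1 - y" y] by auto
  then show ?thesis by (intro continuous_intros) auto
qed

lemma power_term_cells:
  assumes mesh: "admissible_mesh L h" and L: "L > 0" and v: "v \<in> Xh L h" and pos: "\<And>i. nodal h v i > 0"
  shows "power_term L n v = h * (\<Sum>k=1..num_cells L h.
    integral {0..1} (\<lambda>y. ((1 - y) * nodal h v (k - 1) + y * nodal h v k) powr n))"
proof -
  have "power_term L n v = h * (\<Sum>k=1..num_cells L h.
    integral {0..1} (\<lambda>y. ((1 - y) * nodal h v (k - 1) + y * nodal h v (k - 1 + 1)) powr n))"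
    unfolding power_term_def
    by (rule integral_over_period[OF mesh L, of "\<lambda>k y. ((1 - y) * nodal h v k + y * nodal h v (k + 1)) powr n"])
       (auto intro!: continuous_on_affine_powr pos
          arg_cong[where f = "\<lambda>z. z powr n", OF Xh_inside_cell[OF mesh_cells(1)[OF mesh] v]])
  then show ?thesis by simp
qed

text \<open>
  On each cell, the function is at least \<open>1 / C\<close> times the value at the right node.
\<close>

lemma nodal_power_sum_le:
  assumes mesh: "admissible_mesh L h" and L: "L > 0" and v: "v \<in> Xh L h" and pos: "\<And>i. nodal h v i > 0"
    and C: "C \<ge> 1" and osc: "\<And>i. nodal h v (i + 1) \<le> C * nodal h v i" and n: "n > 0"
  shows "h * (\<Sum>i=1..num_cells L h. nodal h v i powr n) \<le> C powr n * power_term L n v"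
proof -
  have "nodal h v k powr n \<le> integral {0..1} (\<lambda>y. C powr n * ((1 - y) * nodal h v (k - 1) + y * nodal h v k) powr n)" for k
  proof -
    have "integral {0..1} (\<lambda>y::real. nodal h v k powr n)
      \<le> integral {0..1} (\<lambda>y. C powr n * ((1 - y) * nodal h v (k - 1) + y * nodal h v k) powr n)"
    proof (intro integral_le integrable_continuous_real continuous_on_mult continuous_on_const continuous_on_affine_powr pos)
      fix y :: real assume y: "y \<in> {0..1}"
      have "nodal h v k \<le> C * nodal h v k" using C pos[of k] by simp
      then have "(1 - y) * nodal h v k + y * nodal h v k \<le> (1 - y) * (C * nodal h v (k - 1)) + y * (C * nodal h v k)"
        using y osc[of "k - 1"] by (intro add_mono mult_left_mono) auto
      then have le: "nodal h v k \<le> C * ((1 - y) * nodal h v (k - 1) + y * nodal h v k)"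
        by (simp add: algebra_simps)
      have "0 \<le> (1 - y) * nodal h v (k - 1) + y * nodal h v k"
        using y pos[of k] pos[of "k - 1"] by simp
      then have "C powr n * ((1 - y) * nodal h v (k - 1) + y * nodal h v k) powr n
          = (C * ((1 - y) * nodal h v (k - 1) + y * nodal h v k)) powr n"
        using C by (simp add: powr_mult)
      then show "nodal h v k powr n \<le> C powr n * ((1 - y) * nodal h v (k - 1) + y * nodal h v k) powr n"
        using le pos[of k] n by (simp add: powr_mono2)
    qed
    then show ?thesis by simp
  qed
  then have "h * (\<Sum>i=1..num_cells L h. nodal h v i powr n) \<le> h * (\<Sum>k=1..num_cells L h. integral {0..1}
      (\<lambda>y. C powr n * ((1 - y) * nodal h v (k - 1) + y * nodal h v k) powr n))"
    using mesh_cells(1)[OF mesh] by (intro mult_left_mono sum_mono) auto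
  also have "\<dots> = C powr n * power_term L n v"
    unfolding power_term_cells[OF mesh L v pos] by (simp add: sum_distrib_left[symmetric])
  finally show ?thesis .
qed

text \<open>
  The estimate at a fixed time and for finitely many modes, for any positive function in \<^const>\<open>Xh\<close>
  with oscillation factor \<open>C\<close>.
\<close>

lemma noise_flux_square_mode_sum_le:
  assumes mesh: "admissible_mesh L h" and L: "L > 0" and n: "2 < n" "n < 3"
    and \<eta>: "\<eta> > 0" and \<epsilon>: "\<epsilon> > 0" and sym: "\<And>l. lam (- l) = lam l"
    and summ: "(\<lambda>l. of_int l ^ 4 * (lam l)\<^sup>2) summable_on UNIV" and F: "finite F"
    and v: "v \<in> Xh L h" and pos: "\<And>i. nodal h v i > 0" and C: "C \<ge> 1"
    and osc: "\<And>i. nodal h v (i + 1) \<le> C * nodal h v i" "\<And>i. nodal h v i \<le> C * nodal h v (i + 1)"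
  shows "1 / (2 * h) * (\<Sum>l\<in>F. (lam l)\<^sup>2 * noise_flux_square L n h l v)
    \<le> (1 + \<eta>) * C_Strat L n lam
        * ((1 + \<epsilon> * ((n - 2) / 2)) * C powr (n - 2) * curvature_term L n h v
          + ((n - 2)\<^sup>2 / 4 + (n - 2) / (2 * \<epsilon>)) * C powr (4 - n) * quartic_slope_term L n h v)
      + 3 * (1 + 1 / \<eta>) * noise_moment lam * (2 / L * (2 * pi / L)\<^sup>2) * (n\<^sup>2 / 4 * C powr (n - 2))
        * slope_term L n h v
      + 3 / 2 * (1 + 1 / \<eta>) * noise_moment lam * (2 / L * (2 * pi / L) ^ 4) * C powr n * power_term L n v"
proof -
  define N where "N = num_cells L h"
  define u where "u = nodal h v"
  define a where "a i = u i powr (n / 2)" for i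
  define c1 where "c1 = (1 + \<epsilon> * ((n - 2) / 2)) * C powr (n - 2)"
  define c2 where "c2 = ((n - 2)\<^sup>2 / 4 + (n - 2) / (2 * \<epsilon>)) * C powr (4 - n)"
  define G1 G2 where "G1 = 2 / L * (2 * pi / L)\<^sup>2" and "G2 = 2 / L * (2 * pi / L) ^ 4"
  define \<mu> where "\<mu> = noise_moment lam"
  have h: "h > 0" by (rule mesh_cells(1)[OF mesh])
  have u: "u i > 0" "u (i + 1) \<le> C * u i" "u i \<le> C * u (i + 1)" "u i \<le> C * u (i - 1)" for i
    using pos[of i] osc[of i] osc(1)[of "i - 1"] by (simp_all add: u_def)
  have uN: "u (i + N) = u i" for i unfolding u_def N_def by (rule periodic_nodal[OF mesh v])
  have aN: "a (i + N) = a i" for i by (simp add: a_def uN)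
  have \<mu>: "\<mu> \<ge> 0" unfolding \<mu>_def noise_moment_def by (intro infsum_nonneg) auto
  have \<Lambda>: "noise_intensity L lam \<ge> 0" unfolding noise_intensity_def using L by (intro add_nonneg_nonneg infsum_nonneg) auto
  have M: "M2h n h v = pw_linear h a"
    unfolding M2h_eq_pw_linear a_def u_def using pos by (simp add: order_less_imp_le)
  have "(\<Sum>l\<in>F. (lam l)\<^sup>2 * noise_flux_square L n h l v)
      = (\<Sum>i=1..N. \<Sum>l\<in>F. (lam l)\<^sup>2 * (LINT x:{0..L}|lborel.
          bdiff h (deriv (\<lambda>y. pw_linear h a y * noise_mode L l y)) x * nodal_basis L h (i + 1) x)\<^sup>2)"
    unfolding noise_flux_square_def M sum_distrib_left N_def by (rule sum.swap)
  also have "\<dots> \<le> (\<Sum>i=1..N. h\<^sup>2 * ((mode_sum_bound L lam \<eta> h a i + mode_sum_bound L lam \<eta> h a (i + 1)) / 2))"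
    by (intro sum_mono noise_flux_mode_sum_le[OF mesh L \<eta> sym summ F] aN[unfolded N_def])
  also have "\<dots> = h\<^sup>2 * ((1 + \<eta>) * noise_intensity L lam * (\<Sum>i=1..N. ((a (i + 1) - 2 * a i + a (i - 1)) / h\<^sup>2)\<^sup>2)
      + 3 * (1 + 1 / \<eta>) * \<mu> * (G1 * (2 * (\<Sum>i=1..N. ((a (i + 1) - a i) / h)\<^sup>2)) + G2 * (\<Sum>i=1..N. (a i)\<^sup>2)))"
    unfolding sum_distrib_left[symmetric] sum_mode_sum_bound[where a = a and N = N and h = h, OF aN] G1_def G2_def \<mu>_def ..
  finally have "1 / (2 * h) * (\<Sum>l\<in>F. (lam l)\<^sup>2 * noise_flux_square L n h l v)
      \<le> 1 / (2 * h) * (h\<^sup>2 * ((1 + \<eta>) * noise_intensity L lam * (\<Sum>i=1..N. ((a (i + 1) - 2 * a i + a (i - 1)) / h\<^sup>2)\<^sup>2)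
      + 3 * (1 + 1 / \<eta>) * \<mu> * (G1 * (2 * (\<Sum>i=1..N. ((a (i + 1) - a i) / h)\<^sup>2)) + G2 * (\<Sum>i=1..N. (a i)\<^sup>2))))"
    using h by (intro mult_left_mono) auto
  also have "\<dots> = (1 + \<eta>) * noise_intensity L lam / 2 * (h * (\<Sum>i=1..N. ((a (i + 1) - 2 * a i + a (i - 1)) / h\<^sup>2)\<^sup>2))
      + 3 * (1 + 1 / \<eta>) * \<mu> * G1 * (h * (\<Sum>i=1..N. ((a (i + 1) - a i) / h)\<^sup>2))
      + 3 / 2 * (1 + 1 / \<eta>) * \<mu> * G2 * (h * (\<Sum>i=1..N. (a i)\<^sup>2))"
  proof -
    have "1 / (2 * h) * (h\<^sup>2 * (A * X + B * (G1 * (2 * Y) + G2 * W)))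
      = A / 2 * (h * X) + B * G1 * (h * Y) + B / 2 * G2 * (h * W)" for A B X Y W
      using h by (simp add: field_simps power2_eq_square)
    from this[of "(1 + \<eta>) * noise_intensity L lam" _ "3 * (1 + 1 / \<eta>) * \<mu>"] show ?thesis by simp
  qed
  also have "\<dots> \<le> (1 + \<eta>) * noise_intensity L lam / 2
        * (n\<^sup>2 / 4 * (c1 * curvature_term L n h v + c2 * quartic_slope_term L n h v))
      + 3 * (1 + 1 / \<eta>) * \<mu> * G1 * (n\<^sup>2 / 4 * C powr (n - 2) * slope_term L n h v)
      + 3 / 2 * (1 + 1 / \<eta>) * \<mu> * G2 * (C powr n * power_term L n v)"
  proof (intro add_mono mult_left_mono)
    have "(\<Sum>i=1..N. ((a (i + 1) - 2 * a i + a (i - 1)) / h\<^sup>2)\<^sup>2)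
        \<le> (\<Sum>i=1..N. n\<^sup>2 / 4 * (c1 * (u i powr (n - 2) * ((u (i + 1) - 2 * u i + u (i - 1)) / h\<^sup>2)\<^sup>2)
          + c2 * (u i powr (n - 4) * (((u (i + 1) - u i) / h)\<^sup>2 + ((u i - u (i - 1)) / h)\<^sup>2)\<^sup>2)))"
      unfolding a_def c1_def c2_def
      by (intro sum_mono powr_second_difference n u C h \<epsilon>)
    also have "\<dots> = n\<^sup>2 / 4 * (c1 * (\<Sum>i=1..N. u i powr (n - 2) * ((u (i + 1) - 2 * u i + u (i - 1)) / h\<^sup>2)\<^sup>2)
          + c2 * (\<Sum>i=1..N. u i powr (n - 4) * (((u (i + 1) - u i) / h)\<^sup>2 + ((u i - u (i - 1)) / h)\<^sup>2)\<^sup>2))"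
      by (simp only: sum_distrib_left[symmetric] sum.distrib)
    finally have "h * (\<Sum>i=1..N. ((a (i + 1) - 2 * a i + a (i - 1)) / h\<^sup>2)\<^sup>2)
        \<le> h * (n\<^sup>2 / 4 * (c1 * (\<Sum>i=1..N. u i powr (n - 2) * ((u (i + 1) - 2 * u i + u (i - 1)) / h\<^sup>2)\<^sup>2)
          + c2 * (\<Sum>i=1..N. u i powr (n - 4) * (((u (i + 1) - u i) / h)\<^sup>2 + ((u i - u (i - 1)) / h)\<^sup>2)\<^sup>2)))"
      using h by (intro mult_left_mono) auto
    also have "\<dots> = n\<^sup>2 / 4 * (c1 * (h * (\<Sum>i=1..N. u i powr (n - 2) * ((u (i + 1) - 2 * u i + u (i - 1)) / h\<^sup>2)\<^sup>2))
          + c2 * (h * (\<Sum>i=1..N. u i powr (n - 4) * (((u (i + 1) - u i) / h)\<^sup>2 + ((u i - u (i - 1)) / h)\<^sup>2)\<^sup>2)))"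
      by (simp only: distrib_left mult.left_commute)
    also have "h * (\<Sum>i=1..N. u i powr (n - 2) * ((u (i + 1) - 2 * u i + u (i - 1)) / h\<^sup>2)\<^sup>2) = curvature_term L n h v"
      unfolding curvature_term_def discrete_laplacian_def N_def u_def
      by (simp only: nodal_pw_linear[OF h] power2_abs)
    also have "h * (\<Sum>i=1..N. u i powr (n - 4) * (((u (i + 1) - u i) / h)\<^sup>2 + ((u i - u (i - 1)) / h)\<^sup>2)\<^sup>2)
        = quartic_slope_term L n h v"
    proof -
      have q: "(x\<^sup>2 + y\<^sup>2)\<^sup>2 = \<bar>x\<bar> ^ 4 + 2 * \<bar>x\<bar>\<^sup>2 * \<bar>y\<bar>\<^sup>2 + \<bar>y\<bar> ^ 4" for x y :: real
        by (simp add: power2_sum power_mult[symmetric])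
      show ?thesis unfolding quartic_slope_term_def fquot_def bquot_def N_def u_def q ..
    qed
    finally show "h * (\<Sum>i=1..N. ((a (i + 1) - 2 * a i + a (i - 1)) / h\<^sup>2)\<^sup>2)
        \<le> n\<^sup>2 / 4 * (c1 * curvature_term L n h v + c2 * quartic_slope_term L n h v)" .
  next
    have "((a (i + 1) - a i) / h)\<^sup>2 \<le> n\<^sup>2 / 4 * C powr (n - 2) * (u i powr (n - 2) * \<bar>fquot h v i\<bar>\<^sup>2)" for i
    proof -
      have "(a (i + 1) - a i)\<^sup>2 \<le> (n/2)\<^sup>2 * C powr (2 * (n/2) - 2) * u i powr (2 * (n/2) - 2) * (u (i + 1) - u i)\<^sup>2"
        unfolding a_def using n by (intro powr_difference u C) auto
      then have "(a (i + 1) - a i)\<^sup>2 / h\<^sup>2 \<le> (n/2)\<^sup>2 * C powr (2 * (n/2) - 2) * u i powr (2 * (n/2) - 2) * (u (i + 1) - u i)\<^sup>2 / h\<^sup>2"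
        by (intro divide_right_mono) auto
      then show ?thesis by (simp add: fquot_def u_def power_divide mult.assoc)
    qed
    then have "h * (\<Sum>i=1..N. ((a (i + 1) - a i) / h)\<^sup>2)
        \<le> h * (\<Sum>i=1..N. n\<^sup>2 / 4 * C powr (n - 2) * (u i powr (n - 2) * \<bar>fquot h v i\<bar>\<^sup>2))"
      using h by (intro mult_left_mono sum_mono) auto
    then show "h * (\<Sum>i=1..N. ((a (i + 1) - a i) / h)\<^sup>2) \<le> n\<^sup>2 / 4 * C powr (n - 2) * slope_term L n h v"
      unfolding slope_term_def sum_distrib_left[symmetric] N_def u_def by (simp only: mult.left_commute)
  next
    have "(a i)\<^sup>2 = u i powr n" for i using u(1)[of i] by (simp add: a_def powr_power)
    then show "h * (\<Sum>i=1..N. (a i)\<^sup>2) \<le> C powr n * power_term L n v"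
      using nodal_power_sum_le[OF mesh L v pos C osc(1), of n] n by (simp add: N_def u_def)
  qed (use \<eta> \<Lambda> \<mu> L in \<open>auto simp: G1_def G2_def intro!: mult_nonneg_nonneg\<close>)
  also have "(1 + \<eta>) * noise_intensity L lam / 2 * (n\<^sup>2 / 4 * X) = (1 + \<eta>) * C_Strat L n lam * X" for X
    by (simp add: C_Strat_def noise_intensity_def)
  finally show ?thesis unfolding c1_def c2_def G1_def G2_def \<mu>_def by (simp only: mult.assoc)
qed

section \<open>Continuity in time\<close>

lemma continuous_on_unit_integral_param:
  fixes f :: "real \<Rightarrow> real \<Rightarrow> real"
  assumes "continuous_on (A \<times> {0..1}) (\<lambda>(s, y). f s y)"
  shows "continuous_on A (\<lambda>s. integral {0..1} (f s))"
  using integral_continuous_on_param[of A 0 1 f] assms by simp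

text \<open>
  Continuity is read off the representation in \<open>flux_against_basis\<close>, in which time only enters
  through the nodal values.
\<close>

lemma continuous_on_noise_flux_square:
  fixes w :: "real \<Rightarrow> real \<Rightarrow> real"
  assumes mesh: "admissible_mesh L h" and L: "L > 0" and n: "n > 0"
    and w: "\<And>s. s \<in> A \<Longrightarrow> w s \<in> Xh L h" and c: "\<And>i. continuous_on A (\<lambda>s. nodal h (w s) i)"
  shows "continuous_on A (\<lambda>s. noise_flux_square L n h l (w s))"
proof -
  obtain g' where g': "continuous_on UNIV g'" "\<And>x. (noise_mode L l has_real_derivative g' x) (at x)"
    using noise_mode_has_derivative[of L l] by auto
  define a where "a s i = \<bar>nodal h (w s) i\<bar> powr (n / 2)" for s i
  have h: "h > 0" by (rule mesh_cells(1)[OF mesh])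
  have ca: "continuous_on A (\<lambda>s. a s i)" for i
    unfolding a_def using n by (intro continuous_on_powr' continuous_intros c) auto
  have ca': "continuous_on (A \<times> {0..1}) (\<lambda>z. a (fst z) i)" for i
    by (rule continuous_on_compose2[OF ca]) (auto intro: continuous_intros)
  have cp: "continuous_on (A \<times> {0..1}) (\<lambda>z. cell_product h (a (fst z)) (noise_mode L l) k (snd z))" for k
    unfolding cell_product_def by (intro continuous_intros ca' continuous_on_compose2[OF continuous_on_noise_mode[of UNIV]]) auto
  have "continuous_on A (\<lambda>s. \<Sum>i=1..num_cells L h. (integral {0..1}
      (\<lambda>y. (cell_product h (a s) (noise_mode L l) (i + 1) y - 2 * cell_product h (a s) (noise_mode L l) i y
        + cell_product h (a s) (noise_mode L l) (i - 1) y) / h))\<^sup>2)"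
    unfolding case_prod_beta
    by (intro continuous_intros continuous_on_unit_integral_param, unfold case_prod_beta)
       (intro continuous_intros cp, use h in auto)
  also have "?this \<longleftrightarrow> ?thesis"
  proof (rule continuous_on_cong)
    fix s assume s: "s \<in> A"
    have "a s (i + num_cells L h) = a s i" for i
      unfolding a_def periodic_nodal[OF mesh w[OF s]] ..
    from flux_against_basis[of L h "a s" "noise_mode L l" g', OF mesh L this noise_mode_periodic[OF L] g'(2) g'(1)]
    show "(\<Sum>i=1..num_cells L h. (integral {0..1}
      (\<lambda>y. (cell_product h (a s) (noise_mode L l) (i + 1) y - 2 * cell_product h (a s) (noise_mode L l) i y
        + cell_product h (a s) (noise_mode L l) (i - 1) y) / h))\<^sup>2) = noise_flux_square L n h l (w s)"
      unfolding noise_flux_square_def M2h_eq_pw_linear a_def[symmetric] by simp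
  qed simp
  finally show ?thesis .
qed

lemma continuous_on_bound_terms:
  fixes w :: "real \<Rightarrow> real \<Rightarrow> real"
  assumes mesh: "admissible_mesh L h" and L: "L > 0"
    and w: "\<And>s. s \<in> A \<Longrightarrow> w s \<in> Xh L h" and c: "\<And>i. continuous_on A (\<lambda>s. nodal h (w s) i)"
    and pos: "\<And>s i. s \<in> A \<Longrightarrow> nodal h (w s) i > 0"
  shows "continuous_on A (\<lambda>s. curvature_term L n h (w s))"
    and "continuous_on A (\<lambda>s. quartic_slope_term L n h (w s))"
    and "continuous_on A (\<lambda>s. slope_term L n h (w s))"
    and "continuous_on A (\<lambda>s. power_term L n (w s))"
proof -
  have h: "h > 0" "h \<noteq> 0" using mesh_cells(1)[OF mesh] by auto
  have ne: "nodal h (w s) i \<noteq> 0" if "s \<in> A" for s i using pos[OF that, of i] by simp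
  show "continuous_on A (\<lambda>s. curvature_term L n h (w s))"
    unfolding curvature_term_def discrete_laplacian_def nodal_pw_linear[OF h(1)]
    by (intro continuous_intros c ballI ne) (use h in auto)
  show "continuous_on A (\<lambda>s. quartic_slope_term L n h (w s))"
    unfolding quartic_slope_term_def fquot_def bquot_def
    by (intro continuous_intros c ballI ne) (use h in auto)
  show "continuous_on A (\<lambda>s. slope_term L n h (w s))"
    unfolding slope_term_def fquot_def
    by (intro continuous_intros c ballI ne) (use h in auto)
  have c': "continuous_on (A \<times> {0..1}) (\<lambda>z. nodal h (w (fst z)) i)" for i
    by (rule continuous_on_compose2[OF c]) (auto intro: continuous_intros)
  have "continuous_on A (\<lambda>s. integral {0..1} (\<lambda>y. ((1 - y) * nodal h (w s) (k - 1) + y * nodal h (w s) k) powr n))" for k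
  proof (rule continuous_on_unit_integral_param, unfold case_prod_beta, intro continuous_on_powr continuous_intros c' ballI)
    fix z :: "real \<times> real" assume z: "z \<in> A \<times> {0..1}"
    then have p: "nodal h (w (fst z)) (k - 1) > 0" "nodal h (w (fst z)) k > 0" using pos by auto
    show "(1 - snd z) * nodal h (w (fst z)) (k - 1) + snd z * nodal h (w (fst z)) k \<noteq> 0"
      using z p convex_bound_lt[of "- nodal h (w (fst z)) (k - 1)" 0 "- nodal h (w (fst z)) k" "1 - snd z" "snd z"]
      by auto
  qed
  then have "continuous_on A (\<lambda>s. h * (\<Sum>k=1..num_cells L h.
      integral {0..1} (\<lambda>y. ((1 - y) * nodal h (w s) (k - 1) + y * nodal h (w s) k) powr n)))"
    by (intro continuous_intros)
  also have "?this \<longleftrightarrow> continuous_on A (\<lambda>s. power_term L n (w s))"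
    by (rule continuous_on_cong) (auto simp: power_term_cells[OF mesh L w pos])
  finally show "continuous_on A (\<lambda>s. power_term L n (w s))" .
qed

section \<open>Energy bounds and oscillation up to the stopping time\<close>

lemma nn_integral_cell_mono:
  assumes "0 \<le> k" "k < num_cells L h" and mesh: "admissible_mesh L h"
    and f: "\<And>x. of_int k * h < x \<Longrightarrow> x < (of_int k + 1) * h \<Longrightarrow> g x \<le> f x"
  shows "(\<integral>\<^sup>+x\<in>{of_int k * h<..<(of_int k + 1) * h}. g x \<partial>lborel) \<le> (\<integral>\<^sup>+x\<in>{0..L}. f x \<partial>lborel)"
proof (rule nn_integral_mono)
  fix x
  note m = mesh_cells[OF mesh]
  have k: "0 \<le> of_int k * h" "(of_int k + 1) * h \<le> L"
  proof -
    show "0 \<le> of_int k * h" using assms m by simp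
    have "of_int (k + 1) * h \<le> of_int (num_cells L h) * h" using assms m by (intro mult_right_mono) auto
    then show "(of_int k + 1) * h \<le> L" using m(2) by simp
  qed
  show "g x * indicator {of_int k * h<..<(of_int k + 1) * h} x \<le> f x * indicator {0..L} x"
    using f k by (auto simp: indicator_def)
qed

lemma deriv_Xh:
  assumes h: "h > 0" and v: "v \<in> Xh L h" and x: "of_int k * h < x" "x < (of_int k + 1) * h"
  shows "deriv v x = fquot h v k"
proof (rule DERIV_imp_deriv)
  have "((\<lambda>x. (1 - (x / h - of_int k)) * nodal h v k + (x / h - of_int k) * nodal h v (k + 1))
      has_real_derivative fquot h v k) (at x)"
    using h by (auto intro!: derivative_eq_intros simp: fquot_def field_simps)
  then show "(v has_real_derivative fquot h v k) (at x)"
    by (rule has_field_derivative_transform_within_open[of _ _ _ "{of_int k * h<..<(of_int k + 1) * h}"])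
       (use x in \<open>auto intro!: Xh_inside_cell[OF h v, symmetric]\<close>)
qed

lemma slope_le_discrete_energy:
  assumes mesh: "admissible_mesh L h" and v: "v \<in> Xh L h" and k: "0 \<le> k" "k < num_cells L h"
  shows "ennreal (h * (fquot h v k)\<^sup>2 / 2) \<le> discrete_energy L cF p h v"
proof -
  have h: "h > 0" by (rule mesh_cells(1)[OF mesh])
  have "ennreal (h * (fquot h v k)\<^sup>2 / 2)
      = (\<integral>\<^sup>+x\<in>{of_int k * h<..<(of_int k + 1) * h}. ennreal ((fquot h v k)\<^sup>2 / 2) \<partial>lborel)"
    using h by (simp add: nn_integral_cmult_indicator ennreal_mult[symmetric] algebra_simps)
  also have "\<dots> \<le> discrete_energy L cF p h v"
    unfolding discrete_energy_def
    by (rule nn_integral_cell_mono[OF k mesh]) (simp add: deriv_Xh[OF h v])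
  finally show ?thesis .
qed

text \<open>
  The hat function of node \<open>i\<close> is at least the linear function increasing from \<open>0\<close> to \<open>1\<close> on the
  cell to the left of the node, whose integral is \<open>h / 2\<close>.
\<close>

lemma potential_le_discrete_energy:
  assumes mesh: "admissible_mesh L h" and i: "1 \<le> i" "i \<le> num_cells L h"
  shows "potential cF p (nodal h v i) * ennreal (h / 2) \<le> discrete_energy L cF p h v"
proof -
  have h: "h > 0" by (rule mesh_cells(1)[OF mesh])
  let ?a = "of_int (i - 1) * h" and ?b = "(of_int (i - 1) + 1) * h"
  let ?f = "\<lambda>x. x / h - of_int (i - 1)"
  have id: "integral {0..1::real} (\<lambda>y. y) = 1 / 2"
    using ident_has_integral[of 0 "1::real"] by (simp add: integral_unique)
  have "set_integrable lborel {?a..?b} ?f \<and> (LINT x:{?a..?b}|lborel. ?f x) = h * integral {0..1} (\<lambda>y. y)"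
    by (rule integral_on_cell[OF h]) auto
  then have int: "set_integrable lborel {?a..?b} ?f" "(LINT x:{?a..?b}|lborel. ?f x) = h / 2"
    by (simp_all add: id)
  have nn: "0 \<le> ?f x" if "x \<in> {?a..?b}" for x
    using that h by (auto simp: field_simps)
  have "(\<integral>\<^sup>+x. ennreal (indicator {?a..?b} x *\<^sub>R ?f x) \<partial>lborel) = ennreal (h / 2)"
  proof -
    have "AE x in lborel. 0 \<le> indicator {?a..?b} x *\<^sub>R ?f x"
      using nn by (intro AE_I2) (simp add: indicator_def)
    from nn_integral_eq_integral[OF int(1)[unfolded set_integrable_def] this] show ?thesis
      unfolding int(2)[unfolded set_lebesgue_integral_def] .
  qed
  also have "(\<integral>\<^sup>+x. ennreal (indicator {?a..?b} x *\<^sub>R ?f x) \<partial>lborel)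
      = (\<integral>\<^sup>+x\<in>{?a<..<?b}. ennreal (?f x) \<partial>lborel)"
  proof (rule nn_integral_cong_AE)
    have "AE x in lborel. x \<noteq> ?a" "AE x in lborel. x \<noteq> ?b" by (rule AE_lborel_singleton)+
    then show "AE x in lborel. ennreal (indicator {?a..?b} x *\<^sub>R ?f x) = ennreal (?f x) * indicator {?a<..<?b} x"
      by eventually_elim (auto simp: indicator_def)
  qed
  finally have hat: "(\<integral>\<^sup>+x\<in>{?a<..<?b}. ennreal (?f x) \<partial>lborel) = ennreal (h / 2)" .
  have "potential cF p (nodal h v i) * ennreal (h / 2)
      = (\<integral>\<^sup>+x. potential cF p (nodal h v i) * (ennreal (?f x) * indicator {?a<..<?b} x) \<partial>lborel)"
    unfolding hat[symmetric] by (rule nn_integral_cmult[symmetric]) simp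
  also have "\<dots> = (\<integral>\<^sup>+x\<in>{?a<..<?b}. potential cF p (nodal h v i) * ennreal (?f x) \<partial>lborel)"
    by (simp only: mult.assoc)
  also have "\<dots> \<le> discrete_energy L cF p h v"
    unfolding discrete_energy_def
  proof (rule nn_integral_cell_mono[OF _ _ mesh])
    fix x assume x: "?a < x" "x < ?b"
    have "?f x < 1" "0 < ?f x" using x h by (auto simp: field_simps)
    then have "?f x \<le> nodal_basis L h i x"
      unfolding nodal_basis_def pw_linear_inside_cell[OF h x] by simp
    then have "potential cF p (nodal h v i) * ennreal (?f x)
        \<le> potential cF p (nodal h v i) * ennreal (nodal_basis L h i x)"
      by (intro mult_left_mono ennreal_leI) auto
    also have "\<dots> \<le> (\<Sum>i=1..num_cells L h. potential cF p (nodal h v i) * ennreal (nodal_basis L h i x))"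
      using i by (intro member_le_sum) auto
    also have "\<dots> \<le> ennreal ((deriv v x)\<^sup>2 / 2)
        + (\<Sum>i=1..num_cells L h. potential cF p (nodal h v i) * ennreal (nodal_basis L h i x))"
      by simp
    finally show "potential cF p (nodal h v i) * ennreal (?f x) \<le> ennreal ((deriv v x)\<^sup>2 / 2)
        + (\<Sum>i=1..num_cells L h. potential cF p (nodal h v i) * ennreal (nodal_basis L h i x))" .
  qed (use i in auto)
  finally show ?thesis .
qed

text \<open>
  With \<open>b = h powr (2 / (p + 2))\<close>, the threshold is \<open>c\<^sub>F / 2\<close> times \<open>h b powr (-p)\<close>, and also \<open>c\<^sub>F / 2\<close>
  times \<open>b\<^sup>2 / h\<close>. The first form is compared with the potential part of the energy at one node, the
  second with the gradient part on one cell.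
\<close>

lemma nodal_bounds_below_max_energy:
  assumes mesh: "admissible_mesh L h" and L: "L > 0" and v: "v \<in> Xh L h"
    and cF: "cF > 0" and p: "p > 0"
    and E: "discrete_energy L cF p h v < ennreal (E_max cF p h)"
  shows "nodal h v i \<ge> h powr (2 / (p + 2))"
    and "\<bar>nodal h v (i + 1) - nodal h v i\<bar> \<le> sqrt cF * h powr (2 / (p + 2))"
proof -
  define N where "N = num_cells L h"
  define b where "b = h powr (2 / (p + 2))"
  have h: "h > 0" by (rule mesh_cells(1)[OF mesh])
  have N1: "N \<ge> 1" unfolding N_def by (rule mesh_cells(3)[OF mesh L])
  have per: "nodal h v (i + N) = nodal h v i" for i
    unfolding N_def by (rule periodic_nodal[OF mesh v])
  have b: "b > 0" using h by (simp add: b_def)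
  have bp: "b powr (- p) = h powr (- ((p - 2) / (p + 2))) / h"
  proof -
    have "- ((p - 2) / (p + 2)) - 1 = 2 / (p + 2) * (- p)" using p by (simp add: field_simps)
    moreover have "h powr (- ((p - 2) / (p + 2)) - 1) = h powr (- ((p - 2) / (p + 2))) / h powr 1"
      by (rule powr_diff)
    ultimately show ?thesis unfolding b_def powr_powr using h by simp
  qed
  have b2: "b\<^sup>2 = h powr (- ((p - 2) / (p + 2))) * h"
  proof -
    have "- ((p - 2) / (p + 2)) + 1 = 2 / (p + 2) * 2" using p by (simp add: field_simps)
    moreover have "h powr (- ((p - 2) / (p + 2)) + 1) = h powr (- ((p - 2) / (p + 2))) * h powr 1"
      by (rule powr_add)
    moreover have "b\<^sup>2 = h powr (2 / (p + 2) * 2)" unfolding b_def using h by (simp add: powr_power mult.commute)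
    ultimately show ?thesis using h by simp
  qed
  have low: "nodal h v i \<ge> b" if i: "i \<in> {1..<1 + N}" for i
  proof -
    have le: "potential cF p (nodal h v i) * ennreal (h / 2) < ennreal (E_max cF p h)"
      using i potential_le_discrete_energy[OF mesh, of i cF p v] E by (auto simp: N_def intro: le_less_trans)
    have pos: "nodal h v i > 0"
    proof (rule ccontr)
      assume "\<not> ?thesis"
      then have "potential cF p (nodal h v i) * ennreal (h / 2) = \<infinity>"
        using h by (simp add: potential_def ennreal_top_mult)
      with le show False by simp
    qed
    then have "cF * nodal h v i powr (- p) * (h / 2) < E_max cF p h"
      using le h cF by (simp add: potential_def ennreal_mult[symmetric] ennreal_less_iff)
    then have "cF / 2 * (nodal h v i powr (- p) * h) < cF / 2 * (b powr (- p) * h)"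
      using h by (simp add: E_max_def bp mult.commute mult.left_commute)
    then have "nodal h v i powr (- p) < b powr (- p)" using cF h by simp
    then have "\<not> nodal h v i < b" using pos p powr_mono2'[of "- p" "nodal h v i" b] by auto
    then show ?thesis by simp
  qed
  show "nodal h v i \<ge> h powr (2 / (p + 2))"
    using periodic_all[of "nodal h v" N 1 "\<lambda>x. b \<le> x", OF per N1 low] by (simp add: b_def)
  have steep: "\<bar>nodal h v (k + 1) - nodal h v k\<bar> \<le> sqrt cF * b" if k: "k \<in> {0..<0 + N}" for k
  proof -
    have "ennreal (h * (fquot h v k)\<^sup>2 / 2) < ennreal (E_max cF p h)"
      using k slope_le_discrete_energy[OF mesh v, of k cF p] E by (auto simp: N_def intro: le_less_trans)
    then have "h * (fquot h v k)\<^sup>2 / 2 < E_max cF p h" using h by (simp add: ennreal_less_iff)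
    then have "2 * h * (h * (fquot h v k)\<^sup>2 / 2) < 2 * h * E_max cF p h" using h by simp
    also have "2 * h * (h * (fquot h v k)\<^sup>2 / 2) = (nodal h v (k + 1) - nodal h v k)\<^sup>2"
      using h by (simp add: fquot_def power_divide power2_eq_square)
    also have "2 * h * E_max cF p h = (sqrt cF * b)\<^sup>2"
      using cF by (simp add: E_max_def power_mult_distrib b2)
    finally show ?thesis using cF b abs_le_square_iff[of "nodal h v (k + 1) - nodal h v k" "sqrt cF * b"]
      by (simp add: abs_mult)
  qed
  have "nodal h v (i + N + 1) - nodal h v (i + N) = nodal h v (i + 1) - nodal h v i" for i
    using per[of "i + 1"] per[of i] by (simp add: algebra_simps)
  from periodic_all[of "\<lambda>i. nodal h v (i + 1) - nodal h v i" N 0 "\<lambda>d. \<bar>d\<bar> \<le> sqrt cF * b", OF this N1 steep]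
  show "\<bar>nodal h v (i + 1) - nodal h v i\<bar> \<le> sqrt cF * h powr (2 / (p + 2))" by (simp add: b_def)
qed

lemma nodal_le_Xh_norm:
  assumes mesh: "admissible_mesh L h" and i: "i \<in> {1..num_cells L h}"
  shows "\<bar>nodal h v i\<bar> \<le> Xh_norm L h v / sqrt h"
proof -
  have h: "h > 0" by (rule mesh_cells(1)[OF mesh])
  have "nodal h v i * nodal h v i \<le> (\<Sum>i=1..num_cells L h. nodal h v i * nodal h v i)"
    using i by (intro member_le_sum) auto
  then have "h * (nodal h v i)\<^sup>2 \<le> discrete_inner L h v v"
    unfolding discrete_inner_def power2_eq_square using h by (intro mult_left_mono) auto
  then have "sqrt (h * (nodal h v i)\<^sup>2) \<le> Xh_norm L h v"
    unfolding Xh_norm_def by (rule real_sqrt_le_mono)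
  then show ?thesis using h by (simp add: real_sqrt_mult field_simps)
qed

lemma continuous_on_nodal_path:
  assumes mesh: "admissible_mesh L h" and L: "L > 0"
    and w: "\<And>t. t \<in> {0..Tmax} \<Longrightarrow> w t \<in> Xh L h"
    and lim: "\<And>t. t \<in> {0..Tmax} \<Longrightarrow> ((\<lambda>s. Xh_norm L h (\<lambda>x. w s x - w t x)) \<longlongrightarrow> 0) (at t within {0..Tmax})"
  shows "continuous_on {0..Tmax} (\<lambda>s. nodal h (w s) i)"
proof -
  have c: "continuous_on {0..Tmax} (\<lambda>s. nodal h (w s) i)" if i: "i \<in> {1..num_cells L h}" for i
    unfolding continuous_on_def
  proof
    fix t assume t: "t \<in> {0..Tmax}"
    have "((\<lambda>s. nodal h (w s) i - nodal h (w t) i) \<longlongrightarrow> 0) (at t within {0..Tmax})"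
    proof (rule Lim_null_comparison)
      show "((\<lambda>s. Xh_norm L h (\<lambda>x. w s x - w t x) / sqrt h) \<longlongrightarrow> 0) (at t within {0..Tmax})"
        using tendsto_divide[OF lim[OF t] tendsto_const, of "sqrt h"] mesh_cells(1)[OF mesh] by simp
      show "\<forall>\<^sub>F s in at t within {0..Tmax}. norm (nodal h (w s) i - nodal h (w t) i)
          \<le> Xh_norm L h (\<lambda>x. w s x - w t x) / sqrt h"
        using nodal_le_Xh_norm[OF mesh i, of "\<lambda>x. w s x - w t x" for s]
        by (intro always_eventually) (simp add: nodal_def)
    qed
    then show "((\<lambda>s. nodal h (w s) i) \<longlongrightarrow> nodal h (w t) i) (at t within {0..Tmax})"
      by (simp add: LIM_zero_iff)
  qed
  have "continuous_on {0..Tmax} (\<lambda>s. if s \<in> {0..Tmax} then nodal h (w s) i else 0)"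
  proof (rule periodic_all[of "\<lambda>i s. if s \<in> {0..Tmax} then nodal h (w s) i else 0" "num_cells L h" 1])
    show "(\<lambda>s. if s \<in> {0..Tmax} then nodal h (w s) (i + num_cells L h) else 0)
        = (\<lambda>s. if s \<in> {0..Tmax} then nodal h (w s) i else 0)" for i
      using periodic_nodal[OF mesh w] by auto
    show "num_cells L h \<ge> 1" by (rule mesh_cells(3)[OF mesh L])
    fix i assume "i \<in> {1..<1 + num_cells L h}"
    then have "i \<in> {1..num_cells L h}" by auto
    from c[OF this] show "continuous_on {0..Tmax} (\<lambda>s. if s \<in> {0..Tmax} then nodal h (w s) i else 0)"
      by (subst continuous_on_cong[OF refl]) auto
  qed
  then show ?thesis by (subst (asm) continuous_on_cong[OF refl]) auto
qed

text \<open>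
  The stopping time is an infimum over a set that contains every time at which the threshold is
  reached.
\<close>

lemma energy_below_max_before_stopping:
  assumes t: "0 \<le> t" "t < stop_time L Tmax cF p h w"
  shows "t < Tmax" "discrete_energy L cF p h (w t) < ennreal (E_max cF p h)"
proof -
  let ?S = "insert Tmax {t\<in>{0..Tmax}. discrete_energy L cF p h (w t) \<ge> ennreal (E_max cF p h)}"
  have "bdd_below ?S" by (auto intro!: bdd_belowI[of _ "min 0 Tmax"])
  moreover have "t < Inf ?S" using t by (simp add: stop_time_def stop_energy_def)
  ultimately have *: "t < s" if "s \<in> ?S" for s using that cInf_lower[of s ?S] by linarith
  show "t < Tmax" using * by auto
  then show "discrete_energy L cF p h (w t) < ennreal (E_max cF p h)" using *[of t] t by force
qed

text \<open>
  The energy bound holds strictly before the stopping time only; its consequences for the nodal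
  values are closed conditions and extend to the endpoint by continuity. The case \<open>\<tau> = 0\<close> has to be
  excluded, since the initial value may already violate the bound.
\<close>

lemma path_up_to_stopping_time:
  assumes mesh: "admissible_mesh L h" and L: "L > 0" and cF: "cF > 0" and p: "p > 0"
    and w: "\<And>t. t \<in> {0..Tmax} \<Longrightarrow> w t \<in> Xh L h"
    and lim: "\<And>t. t \<in> {0..Tmax} \<Longrightarrow> ((\<lambda>s. Xh_norm L h (\<lambda>x. w s x - w t x)) \<longlongrightarrow> 0) (at t within {0..Tmax})"
    and \<tau>: "\<tau> \<le> Tmax" "\<tau> \<le> stop_time L Tmax cF p h w" and s: "0 < \<tau>" "s \<in> {0..\<tau>}"
  shows "nodal h (w s) i > 0" "nodal h (w s) (i + 1) \<le> C_osc cF * nodal h (w s) i"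
    "nodal h (w s) i \<le> C_osc cF * nodal h (w s) (i + 1)"
proof -
  define b where "b = h powr (2 / (p + 2))"
  have b: "b > 0" using mesh_cells(1)[OF mesh] by (simp add: b_def)
  \<comment> \<open>A closed condition on the half-open interval passes to its closure.\<close>
  have cl: "closure {0..<\<tau>} = {0..\<tau>}" using s by simp
  have c: "continuous_on (closure {0..<\<tau>}) (\<lambda>s. nodal h (w s) i)" for i
    unfolding cl by (rule continuous_on_subset[OF continuous_on_nodal_path[OF mesh L w lim]]) (use \<tau> in auto)
  have before: "nodal h (w r) i \<ge> b" "\<bar>nodal h (w r) (i + 1) - nodal h (w r) i\<bar> \<le> sqrt cF * b"
    if r: "r \<in> {0..<\<tau>}" for r i
  proof -
    have "r \<in> {0..Tmax}" "discrete_energy L cF p h (w r) < ennreal (E_max cF p h)"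
      using r \<tau> energy_below_max_before_stopping[of r L Tmax cF p h w] by auto
    from nodal_bounds_below_max_energy[OF mesh L w[OF this(1)] cF p this(2)]
    show "nodal h (w r) i \<ge> b" "\<bar>nodal h (w r) (i + 1) - nodal h (w r) i\<bar> \<le> sqrt cF * b"
      unfolding b_def by auto
  qed
  have low: "nodal h (w s) i \<ge> b" for i
    by (rule continuous_ge_on_closure[OF c]) (use s cl before in auto)
  have diff: "\<bar>nodal h (w s) (i + 1) - nodal h (w s) i\<bar> \<le> sqrt cF * b" for i
  proof -
    have "continuous_on (closure {0..<\<tau>}) (\<lambda>s. \<bar>nodal h (w s) (i + 1) - nodal h (w s) i\<bar>)"
      by (intro continuous_intros c)
    then show ?thesis
      by (rule continuous_le_on_closure) (use s cl before in auto)
  qed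
  show "nodal h (w s) i > 0" using low[of i] b by simp
  have osc: "y \<le> C_osc cF * x" if "\<bar>y - x\<bar> \<le> sqrt cF * b" "b \<le> x" for x y
  proof -
    have "sqrt cF * b \<le> sqrt (2 * cF) * x"
      using that b cF by (intro mult_mono real_sqrt_le_mono) auto
    then show ?thesis using that by (simp add: C_osc_def algebra_simps)
  qed
  show "nodal h (w s) (i + 1) \<le> C_osc cF * nodal h (w s) i"
    by (rule osc[OF diff low])
  show "nodal h (w s) i \<le> C_osc cF * nodal h (w s) (i + 1)"
    by (rule osc) (use diff[of i] low in \<open>auto simp: abs_minus_commute\<close>)
qed

section \<open>Integration in time\<close>

lemma set_integral_nonpos_interval:
  fixes f :: "real \<Rightarrow> real"
  assumes "\<tau> \<le> 0" shows "(LINT s:{0..\<tau>}|lborel. f s) = 0"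
proof (cases "\<tau> = 0")
  case True
  then show ?thesis by (simp add: set_integral_at_point[OF set_borel_integrable_singleton])
qed (use assms in \<open>simp add: set_lebesgue_integral_def\<close>)

lemma set_integral_finite_sum:
  fixes f :: "'i \<Rightarrow> 'a \<Rightarrow> real"
  assumes "finite F" and f: "\<And>l. set_integrable M A (f l)"
  shows "set_integrable M A (\<lambda>x. \<Sum>l\<in>F. f l x)
    \<and> (LINT x:A|M. \<Sum>l\<in>F. f l x) = (\<Sum>l\<in>F. LINT x:A|M. f l x)"
  using assms(1)
proof induction
  case empty
  then show ?case by (simp add: set_integrable_def set_lebesgue_integral_def)
qed (simp add: set_integral_add f)

text \<open>
  The pathwise estimate. If the time interval is degenerate, all integrals vanish. Otherwise the
  integrands are continuous on the closed interval; this is essential on the right-hand side as well,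
  where the integral of a non-integrable function would be zero by convention.
\<close>

lemma noise_flux_time_integral_le:
  fixes w :: "real \<Rightarrow> real \<Rightarrow> real"
  assumes mesh: "admissible_mesh L h" and L: "L > 0" and n: "2 < n" "n < 3"
    and cF: "cF > 0" and p: "p > 0" and \<eta>: "\<eta> > 0" and \<epsilon>: "\<epsilon> > 0"
    and sym: "\<And>l. lam (- l) = lam l"
    and summ: "(\<lambda>l. of_int l ^ 4 * (lam l)\<^sup>2) summable_on UNIV"
    and w: "\<And>t. t \<in> {0..Tmax} \<Longrightarrow> w t \<in> Xh L h"
    and lim: "\<And>t. t \<in> {0..Tmax} \<Longrightarrow> ((\<lambda>s. Xh_norm L h (\<lambda>x. w s x - w t x)) \<longlongrightarrow> 0) (at t within {0..Tmax})"
    and \<tau>: "\<tau> \<le> Tmax" "\<tau> \<le> stop_time L Tmax cF p h w"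
    and C1: "3 * (1 + 1 / \<eta>) * noise_moment lam * (2 / L * (2 * pi / L)\<^sup>2) * (n\<^sup>2 / 4 * C_osc cF powr (n - 2)) \<le> C1"
    and C2: "3 / 2 * (1 + 1 / \<eta>) * noise_moment lam * (2 / L * (2 * pi / L) ^ 4) * C_osc cF powr n \<le> C2"
  defines "R \<equiv> (1 + \<eta>) * C_Strat L n lam
        * ((1 + \<epsilon> * ((n - 2) / 2)) * C_osc cF powr (n - 2) * (LINT s:{0..\<tau>}|lborel. curvature_term L n h (w s))
          + ((n - 2)\<^sup>2 / 4 + (n - 2) / (2 * \<epsilon>)) * C_osc cF powr (4 - n)
            * (LINT s:{0..\<tau>}|lborel. quartic_slope_term L n h (w s)))
      + C1 * (LINT s:{0..\<tau>}|lborel. slope_term L n h (w s))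
      + C2 * (LINT s:{0..\<tau>}|lborel. power_term L n (w s))"
  shows "(\<lambda>l. (lam l)\<^sup>2 * (LINT s:{0..\<tau>}|lborel. noise_flux_square L n h l (w s))) summable_on UNIV
    \<and> 1 / (2 * h) * (\<Sum>\<^sub>\<infinity>l. (lam l)\<^sup>2 * (LINT s:{0..\<tau>}|lborel. noise_flux_square L n h l (w s))) \<le> R"
proof (cases "0 < \<tau>")
  case False
  then show ?thesis unfolding R_def by (simp add: set_integral_nonpos_interval)
next
  case True
  have path: "nodal h (w s) i > 0" "nodal h (w s) (i + 1) \<le> C_osc cF * nodal h (w s) i"
    "nodal h (w s) i \<le> C_osc cF * nodal h (w s) (i + 1)" if "s \<in> {0..\<tau>}" for s i
    using path_up_to_stopping_time[OF mesh L cF p w lim \<tau> True that] by blast+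
  have h: "h > 0" by (rule mesh_cells(1)[OF mesh])
  have C: "C_osc cF \<ge> 1" using cF by (simp add: C_osc_def)
  have wt: "w s \<in> Xh L h" if "s \<in> {0..\<tau>}" for s using that \<tau> by (intro w) auto
  have c: "continuous_on {0..\<tau>} (\<lambda>s. nodal h (w s) i)" for i
    by (rule continuous_on_subset[OF continuous_on_nodal_path[OF mesh L w lim]]) (use \<tau> in auto)
  note int = borel_integrable_atLeastAtMost'
  have iQ: "set_integrable lborel {0..\<tau>} (\<lambda>s. noise_flux_square L n h l (w s))" for l
    by (intro int continuous_on_noise_flux_square[OF mesh L _ wt c]) (use n in auto)
  have iK: "set_integrable lborel {0..\<tau>} (\<lambda>s. curvature_term L n h (w s))"
    and iP: "set_integrable lborel {0..\<tau>} (\<lambda>s. quartic_slope_term L n h (w s))"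
    and iS: "set_integrable lborel {0..\<tau>} (\<lambda>s. slope_term L n h (w s))"
    and iM: "set_integrable lborel {0..\<tau>} (\<lambda>s. power_term L n (w s))"
    by (intro int continuous_on_bound_terms[OF mesh L wt c path(1)]; assumption)+
  define X where "X l = (lam l)\<^sup>2 * (LINT s:{0..\<tau>}|lborel. noise_flux_square L n h l (w s))" for l
  have X0: "X l \<ge> 0" for l
  proof -
    have "0 \<le> noise_flux_square L n h l (w s)" for s
      unfolding noise_flux_square_def by (intro sum_nonneg) auto
    then show ?thesis
      unfolding X_def set_lebesgue_integral_def
      by (intro mult_nonneg_nonneg integral_nonneg_AE AE_I2) auto
  qed
  define k where "k = (1 + \<eta>) * C_Strat L n lam"
  define a where "a = (1 + \<epsilon> * ((n - 2) / 2)) * C_osc cF powr (n - 2)"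
  define b where "b = ((n - 2)\<^sup>2 / 4 + (n - 2) / (2 * \<epsilon>)) * C_osc cF powr (4 - n)"
  have fin: "(\<Sum>l\<in>F. X l) \<le> 2 * h * R" if F: "finite F" for F
  proof -
    have "1 / (2 * h) * (\<Sum>l\<in>F. X l)
        = (LINT s:{0..\<tau>}|lborel. 1 / (2 * h) * (\<Sum>l\<in>F. (lam l)\<^sup>2 * noise_flux_square L n h l (w s)))"
      using set_integral_finite_sum[OF F set_integrable_mult_right[OF iQ], of "\<lambda>l. (lam l)\<^sup>2" "\<lambda>l. l"]
      by (simp add: X_def)
    also have "\<dots> \<le> (LINT s:{0..\<tau>}|lborel. k * (a * curvature_term L n h (w s) + b * quartic_slope_term L n h (w s))
        + C1 * slope_term L n h (w s) + C2 * power_term L n (w s))"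
    proof (rule set_integral_mono)
      show "set_integrable lborel {0..\<tau>} (\<lambda>s. 1 / (2 * h) * (\<Sum>l\<in>F. (lam l)\<^sup>2 * noise_flux_square L n h l (w s)))"
        using iQ by (intro set_integrable_mult_right conjunct1[OF set_integral_finite_sum[OF F]])
      show "set_integrable lborel {0..\<tau>} (\<lambda>s. k * (a * curvature_term L n h (w s) + b * quartic_slope_term L n h (w s))
        + C1 * slope_term L n h (w s) + C2 * power_term L n (w s))"
        by (intro set_integral_add(1) set_integrable_mult_right iK iP iS iM)
      fix s assume s: "s \<in> {0..\<tau>}"
      have S: "0 \<le> slope_term L n h (w s)"
        unfolding slope_term_def using h by (intro mult_nonneg_nonneg sum_nonneg) auto
      have M: "0 \<le> power_term L n (w s)"
        unfolding power_term_def set_lebesgue_integral_def by (intro integral_nonneg_AE AE_I2) auto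
      from noise_flux_square_mode_sum_le[OF mesh L n \<eta> \<epsilon> sym summ F wt[OF s] path(1)[OF s] C path(2,3)[OF s]]
        mult_right_mono[OF C1 S] mult_right_mono[OF C2 M]
      show "1 / (2 * h) * (\<Sum>l\<in>F. (lam l)\<^sup>2 * noise_flux_square L n h l (w s))
          \<le> k * (a * curvature_term L n h (w s) + b * quartic_slope_term L n h (w s))
            + C1 * slope_term L n h (w s) + C2 * power_term L n (w s)"
        unfolding k_def a_def b_def by linarith
    qed
    also have "\<dots> = R"
      unfolding R_def k_def[symmetric] a_def[symmetric] b_def[symmetric]
      using iK iP iS iM by (simp add: set_integral_add)
    finally show ?thesis using h by (simp add: field_simps)
  qed
  have sm: "X summable_on UNIV"
    by (rule nonneg_bdd_above_summable_on) (auto simp: X0 intro!: bdd_aboveI[of _ "2 * h * R"] fin)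
  have "(\<Sum>\<^sub>\<infinity>l. X l) \<le> 2 * h * R" by (rule infsum_le_finite_sums[OF sm fin])
  then have "1 / (2 * h) * (\<Sum>\<^sub>\<infinity>l. X l) \<le> R" using h by (simp add: field_simps)
  with sm show ?thesis unfolding X_def by simp
qed

theorem lemmaA5:
  fixes L Tmax n p cF S :: real
    and Lam :: "(real \<Rightarrow> real) measure"
    and M :: "'w measure" and F :: "real \<Rightarrow> 'w measure"
    and lam :: "int \<Rightarrow> real" and \<beta> :: "int \<Rightarrow> real \<Rightarrow> 'w \<Rightarrow> real"
    and W :: "real \<Rightarrow> 'w \<Rightarrow> real \<Rightarrow> real" and u0 :: "'w \<Rightarrow> real \<Rightarrow> real"
    and N :: "real \<Rightarrow> nat"
  assumes domain: "L > 0" "Tmax > 0"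
    and A1: "2 < n" "n < 3"
    and A2: "cF > 0" "p > n"
    and A3: "initial_law L cF p Lam"
    and A4: "stochastic_basis M F" "Q_wiener_process L M F lam \<beta> W"
      "u0 \<in> F 0 \<rightarrow>\<^sub>M H1per_borel L" "Lam = distr M (H1per_borel L) u0"
    and A5: "S > C_Strat L n lam
                 * (3 * C_osc cF powr (4 - n) / (1 + C_osc cF) powr (n - 4))
                 * ((n - 2) / (3 - n))
               + C_Strat L n lam * (C_osc cF powr (n - 2) - 1)"
    and N: "filterlim N at_top (at 0 within {h. admissible_mesh L h})"
  shows "\<forall>\<eta>>0. \<exists>C1>0. \<exists>C2>0. \<forall>\<epsilon>>0. \<forall>h u q.
    admissible_mesh L h \<longrightarrow> scheme_solution L Tmax n p cF S M F lam \<beta> N u0 h u q \<longrightarrow>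
    (AE \<omega> in M. \<forall>t\<in>{0..Tmax}.
       (\<lambda>l. (lam l)\<^sup>2 * (LINT s:{0..min t (stop_time L Tmax cF p h (u \<omega>))}|lborel.
          \<Sum>i=1..num_cells L h. (LINT x:{0..L}|lborel.
            bdiff h (deriv (\<lambda>y. M2h n h (u \<omega> s) y * noise_mode L l y)) x
              * nodal_basis L h (i + 1) x)\<^sup>2)) summable_on UNIV
       \<and>
       1 / (2 * h) * (\<Sum>\<^sub>\<infinity>l. (lam l)\<^sup>2 *
         (LINT s:{0..min t (stop_time L Tmax cF p h (u \<omega>))}|lborel.
            \<Sum>i=1..num_cells L h. (LINT x:{0..L}|lborel.
              bdiff h (deriv (\<lambda>y. M2h n h (u \<omega> s) y * noise_mode L l y)) x
                * nodal_basis L h (i + 1) x)\<^sup>2))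
       \<le> (1 + \<eta>) * C_Strat L n lam *
           ((1 + \<epsilon> * ((n - 2) / 2)) * C_osc cF powr (n - 2) *
              (LINT s:{0..min t (stop_time L Tmax cF p h (u \<omega>))}|lborel.
                 h * (\<Sum>i=1..num_cells L h. nodal h (u \<omega> s) i powr (n - 2)
                        * \<bar>nodal h (discrete_laplacian h (u \<omega> s)) i\<bar>\<^sup>2))
            + ((n - 2)\<^sup>2 / 4 + (n - 2) / (2 * \<epsilon>)) * C_osc cF powr (4 - n) *
              (LINT s:{0..min t (stop_time L Tmax cF p h (u \<omega>))}|lborel.
                 h * (\<Sum>i=1..num_cells L h. nodal h (u \<omega> s) i powr (n - 4)
                        * (\<bar>fquot h (u \<omega> s) i\<bar> ^ 4
                           + 2 * \<bar>fquot h (u \<omega> s) i\<bar>\<^sup>2 * \<bar>bquot h (u \<omega> s) i\<bar>\<^sup>2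
                           + \<bar>bquot h (u \<omega> s) i\<bar> ^ 4))))
         + C1 * (LINT s:{0..min t (stop_time L Tmax cF p h (u \<omega>))}|lborel.
                   h * (\<Sum>i=1..num_cells L h. nodal h (u \<omega> s) i powr (n - 2)
                          * \<bar>fquot h (u \<omega> s) i\<bar>\<^sup>2))
         + C2 * (LINT s:{0..min t (stop_time L Tmax cF p h (u \<omega>))}|lborel.
                   LINT x:{0..L}|lborel. u \<omega> s x powr n))"
proof -
  have sym: "\<And>l. lam (- l) = lam l" and summ: "(\<lambda>l. of_int l ^ 4 * (lam l)\<^sup>2) summable_on UNIV"
  proof -
    have "(\<forall>l. lam (- l) = lam l) \<and> (\<lambda>l. of_int l ^ 4 * (lam l)\<^sup>2) summable_on UNIV"
      using A4(2) unfolding Q_wiener_process_def by (elim conjE) (intro conjI; assumption)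
    then show "lam (- l) = lam l" "(\<lambda>l. of_int l ^ 4 * (lam l)\<^sup>2) summable_on UNIV" for l
      by simp_all
  qed
  have p: "p > 0" using A1 A2 by simp
  define c1 where "c1 \<eta> = 3 * (1 + 1 / \<eta>) * noise_moment lam * (2 / L * (2 * pi / L)\<^sup>2)
    * (n\<^sup>2 / 4 * C_osc cF powr (n - 2))" for \<eta>
  define c2 where "c2 \<eta> = 3 / 2 * (1 + 1 / \<eta>) * noise_moment lam * (2 / L * (2 * pi / L) ^ 4) * C_osc cF powr n" for \<eta>
  have "noise_moment lam \<ge> 0" unfolding noise_moment_def by (intro infsum_nonneg) auto
  then have c: "c1 \<eta> + 1 > 0" "c2 \<eta> + 1 > 0" if "\<eta> > 0" for \<eta>
    unfolding c1_def c2_def using that domain by (auto intro!: add_nonneg_pos mult_nonneg_nonneg)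
  \<comment> \<open>The summand 1 makes the constants positive even if there is no noise.\<close>
  have witnesses: "\<forall>\<eta>>0. \<exists>C1>0. \<exists>C2>0. P \<eta> C1 C2" if "\<And>\<eta>. \<eta> > 0 \<Longrightarrow> P \<eta> (c1 \<eta> + 1) (c2 \<eta> + 1)" for P
  proof (intro allI impI)
    fix \<eta> :: real assume "\<eta> > 0"
    then show "\<exists>C1>0. \<exists>C2>0. P \<eta> C1 C2"
      using that[of \<eta>] c[of \<eta>] by (intro exI[of _ "c1 \<eta> + 1"] exI[of _ "c2 \<eta> + 1"] conjI)
  qed
  show ?thesis
    unfolding noise_flux_square_def[symmetric] curvature_term_def[symmetric]
      quartic_slope_term_def[symmetric] slope_term_def[symmetric] power_term_def[symmetric]
  proof (rule witnesses, intro allI impI, goal_cases)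
    case (1 \<eta> \<epsilon> h u q)
    have path: "u \<omega> t \<in> Xh L h"
      "((\<lambda>s. Xh_norm L h (\<lambda>x. u \<omega> s x - u \<omega> t x)) \<longlongrightarrow> 0) (at t within {0..Tmax})"
      if "\<omega> \<in> space M" "t \<in> {0..Tmax}" for \<omega> t
      using 1(4) that unfolding scheme_solution_def L2_C_Xh_def by auto
    show ?case
    proof (intro AE_I2 ballI, goal_cases)
      case (1 \<omega> t)
      then show ?case
        by (intro noise_flux_time_integral_le[OF \<open>admissible_mesh L h\<close> domain(1) A1 A2(1) p \<open>\<eta> > 0\<close> \<open>\<epsilon> > 0\<close> sym summ path])
          (auto simp: c1_def c2_def)
    qed
  qed
qed

end
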